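(* Let $K$ be a field and let $B\subseteq\mathbb Z^n$ be a simplicial affine semigroup with chosen linearly independent elements $e_1,\ldots,e_d\in B$ satisfying $C(\{e_1,\ldots,e_d\})=C(B)$. Let $A=\langle e_1,\ldots,e_d\rangle$, $T=K[A]$, let $h_1,\ldots,h_f$ be the elements constructed in the context, and let $\tilde B=\langle e_1,\ldots,e_d,h_1,\ldots,h_f\rangle$. Then $$K[\tilde B]\cong\bigoplus_{j=1}^{f}T(-h_j)$$ as $\mathbb Z^n$-graded $T$-modules.
   Context: An affine semigroup is a finitely generated submonoid of $(\mathbb Z^n,+)$ for some $n\in\mathbb N^+$ (here $0\in\mathbb N$). For a field $K$ and an affine semigroup $S\subseteq\mathbb Z^n$, $K[S]$ is the affine semigroup ring: the $K$-vector space with basis $\{t^s\mid s\in S\}$ and multiplication given by the $K$-bilinear extension of $t^a\cdot t^b=t^{a+b}$. It is $\mathbb Z^n$-graded by $\deg t^a=a$. For a $\mathbb Z^n$-graded module $M$ and $h\in\mathbb Z^n$, $M(-h)$ is the shifted module with $M(-h)_g=M_{g-h}$. For $X\subseteq\mathbb Q^n$, $C(X):=\{\sum\lambda_ix_i \text{ (finite sums)}\mid \lambda_i\in\mathbb Q_{\ge0},\ x_i\in X\}$ is the cone spanned by $X$; for $X\subseteq\mathbb Z^n$, $G(X)$ is the subgroup of $\mathbb Z^n$ generated by $X$, and $\langle X\rangle$ is the submonoid generated by $X$. An affine semigroup $B\subseteq\mathbb Z^n$ is simplicial if there are linearly independent $e_1,\ldots,e_d\in B$ with $C(\{e_1,\ldots,e_d\})=C(B)$.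 Fix such $e_1,\ldots,e_d$ and put $A:=\langle e_1,\ldots,e_d\rangle\subseteq B$; then $T:=K[A]$ is a polynomial ring in $d$ variables. For $x\in G(B)$ let $\lambda_1^x,\ldots,\lambda_d^x\in\mathbb Q$ be the unique rationals with $x=\sum_{i=1}^d\lambda_i^xe_i$. For $x,y\in G(B)$ write $x\sim y$ if $x-y\in G(A)$; this is an equivalence relation on $G(B)$. Define $$B_A:=\{x\in B\mid x-a\notin B\ \text{for all } a\in A\setminus\{0\}\},$$ which is a finite set. Let $\Gamma_1,\ldots,\Gamma_f$ be the equivalence classes of $\sim$ on $B_A$ (their number $f$ is finite), and for $j=1,\ldots,f$ define $$h_j:=\sum_{i=1}^d\min\{\lambda_i^x\mid x\in\Gamma_j\}\,e_i .$$ One has $h_j\in C(B)\cap G(B)$, in particular $h_j\in\mathbb Z^n$. Set $\tilde B:=\langle e_1,\ldots,e_d,h_1,\ldots,h_f\rangle$; since $A\subseteq\tilde B$, $K[\tilde B]$ is a $T$-module via $T\subseteq K[\tilde B]$. *)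

theory Defs
  imports
    "HOL-Analysis.Analysis"
    "HOL-Algebra.Module"
    "HOL-Algebra.AbelCoset"
    "HOL-Library.Poly_Mapping"
    "HOL-Computational_Algebra.Group_Closure"
begin

section \<open>Affine semigroups\<close>

inductive_set monoid_closure :: "'g::monoid_add set \<Rightarrow> 'g set" for X where
  zero: "0 \<in> monoid_closure X"
| base: "x \<in> X \<Longrightarrow> x \<in> monoid_closure X"
| add: "x \<in> monoid_closure X \<Longrightarrow> y \<in> monoid_closure X \<Longrightarrow> x + y \<in> monoid_closure X"

definition affine_semigroup :: "(int ^ 'n::finite) set \<Rightarrow> bool" where
  "affine_semigroup S \<longleftrightarrow> (\<exists>F. finite F \<and> S = monoid_closure F)"

definition rat_vec :: "int ^ 'n \<Rightarrow> rat ^ 'n" where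
  "rat_vec v = (\<chi> k. rat_of_int (v $ k))"

definition rat_cone :: "(rat ^ 'n) set \<Rightarrow> (rat ^ 'n) set" where
  "rat_cone X = {(\<Sum>x\<in>F. c x *s x) | F c. finite F \<and> F \<subseteq> X \<and> (\<forall>x\<in>F. 0 \<le> c x)}"

text \<open>The family \<open>e 1, \<dots>, e d\<close> is linearly independent over the rationals iff it is
  injective and its image is an independent set.\<close>

definition simplicial_by :: "(int ^ 'n::finite) set \<Rightarrow> nat \<Rightarrow> (nat \<Rightarrow> int ^ 'n) \<Rightarrow> bool" where
  "simplicial_by B d e \<longleftrightarrow>
     e ` {1..d} \<subseteq> B \<and>
     inj_on e {1..d} \<and> vec.independent (rat_vec ` e ` {1..d}) \<and>
     rat_cone (rat_vec ` e ` {1..d}) = rat_cone (rat_vec ` B)"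

text \<open>The coefficient \<open>\<lambda>\<^sub>i\<^sup>x\<close> of \<open>x\<close> at \<open>e i\<close>.\<close>

definition coord :: "nat \<Rightarrow> (nat \<Rightarrow> int ^ 'n::finite) \<Rightarrow> int ^ 'n \<Rightarrow> nat \<Rightarrow> rat" where
  "coord d e x i = vec.representation (rat_vec ` e ` {1..d}) (rat_vec x) (rat_vec (e i))"

definition minimal_elements :: "'g::ab_group_add set \<Rightarrow> 'g set \<Rightarrow> 'g set" where
  "minimal_elements B A = {x \<in> B. \<forall>a \<in> A - {0}. x - a \<notin> B}"

definition minimal_classes :: "'g::ab_group_add set \<Rightarrow> 'g set \<Rightarrow> 'g set set" where
  "minimal_classes B A = minimal_elements B A //
     {(x, y). x \<in> minimal_elements B A \<and> y \<in> minimal_elements B A \<and> x - y \<in> group_closure A}"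

text \<open>The vector \<open>h\<^sub>j\<close> attached to the class \<open>\<Gamma>\<^sub>j\<close>. It is defined by a formula in rational
  vectors; that the description is satisfied, by an element of \<open>group_closure B\<close>, is
  \<open>rat_vec_h_vec\<close> and \<open>h_vec_in_group_closure\<close> below.\<close>

definition h_vec :: "nat \<Rightarrow> (nat \<Rightarrow> int ^ 'n::finite) \<Rightarrow> (int ^ 'n) set \<Rightarrow> int ^ 'n" where
  "h_vec d e \<Gamma> = (THE h. rat_vec h =
     (\<Sum>i = 1..d. Min ((\<lambda>x. coord d e x i) ` \<Gamma>) *s rat_vec (e i)))"

subsection \<open>Finiteness of the minimal elements and integrality of the vectors \<open>h\<close>\<close>

lemma rat_vec_add: "rat_vec (x + y) = rat_vec x + rat_vec y"
  by (simp add: rat_vec_def vec_eq_iff)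

lemma rat_vec_diff: "rat_vec (x - y) = rat_vec x - rat_vec y"
  by (simp add: rat_vec_def vec_eq_iff)

lemma rat_vec_0: "rat_vec 0 = 0"
  by (simp add: rat_vec_def vec_eq_iff)

lemma rat_vec_smult: "rat_vec (k *s x) = rat_of_int k *s rat_vec x"
  by (simp add: rat_vec_def vec_eq_iff)

lemma rat_vec_sum: "rat_vec (sum f I) = (\<Sum>i\<in>I. rat_vec (f i))"
  by (induction I rule: infinite_finite_induct) (auto simp: rat_vec_0 rat_vec_add)

lemma rat_vec_eq_iff: "rat_vec x = rat_vec y \<longleftrightarrow> x = y"
  by (simp add: rat_vec_def vec_eq_iff)

lemma monoid_closure_smult:
  fixes x :: "int ^ 'n::finite"
  assumes "x \<in> monoid_closure X"
  shows "int k *s x \<in> monoid_closure X"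
proof (induction k)
  case (Suc k)
  have "int (Suc k) *s x = x + int k *s x"
    by (simp add: vec_eq_iff algebra_simps)
  with Suc assms show ?case by (auto intro: monoid_closure.add)
qed (auto intro: monoid_closure.zero)

lemma monoid_closure_sum:
  fixes f :: "'i \<Rightarrow> 'g::comm_monoid_add"
  assumes "\<And>i. i \<in> I \<Longrightarrow> f i \<in> monoid_closure X"
  shows "sum f I \<in> monoid_closure X"
  using assms
  by (induction I rule: infinite_finite_induct)
     (auto intro: monoid_closure.intros)

lemma monoid_closure_eq_sum:
  fixes x :: "int ^ 'n::finite"
  assumes "finite F" "x \<in> monoid_closure F"
  shows "\<exists>k. x = (\<Sum>b\<in>F. int (k b) *s b)"
  using assms(2)
proof induction
  case zero
  show ?case by (rule exI[of _ "\<lambda>_. 0"]) simp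
next
  case (base x)
  have "(\<Sum>b\<in>F. int (if b = x then 1 else 0) *s b) = (\<Sum>b\<in>F. if b = x then x else 0)"
    by (rule sum.cong) auto
  also have "\<dots> = x" using base assms(1) by simp
  finally show ?case by (intro exI[of _ "\<lambda>b. if b = x then 1 else 0"]) simp
next
  case (add x y)
  then obtain k l where "x = (\<Sum>b\<in>F. int (k b) *s b)" "y = (\<Sum>b\<in>F. int (l b) *s b)" by blast
  then have "x + y = (\<Sum>b\<in>F. int (k b + l b) *s b)"
    by (simp add: sum.distrib[symmetric] vec_eq_iff algebra_simps)
  then show ?case by (intro exI[of _ "\<lambda>b. k b + l b"])
qed

lemma group_closure_smult:
  fixes x :: "int ^ 'n::finite"
  assumes "x \<in> group_closure X"
  shows "k *s x \<in> group_closure X"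
proof -
  have *: "int m *s x \<in> group_closure X" for m
  proof (induction m)
    case (Suc m)
    have "int (Suc m) *s x = x + int m *s x"
      by (simp add: vec_eq_iff algebra_simps)
    with Suc assms show ?case by (auto intro: group_closure_add)
  qed auto
  show ?thesis
  proof (cases "k \<ge> 0")
    case True
    then show ?thesis using *[of "nat k"] by simp
  next
    case False
    have "k *s x = - (int (nat (- k)) *s x)" using False by (simp add: vec_eq_iff)
    then show ?thesis using *[of "nat (- k)"] by simp
  qed
qed

lemma group_closure_sum:
  fixes f :: "'i \<Rightarrow> 'g::ab_group_add"
  assumes "\<And>i. i \<in> I \<Longrightarrow> f i \<in> group_closure X"
  shows "sum f I \<in> group_closure X"
  using assms
  by (induction I rule: infinite_finite_induct) (auto intro: group_closure_add)

lemma group_closure_mono: "X \<subseteq> group_closure Y \<Longrightarrow> group_closure X \<subseteq> group_closure Y"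
proof
  fix x assume "X \<subseteq> group_closure Y" "x \<in> group_closure X"
  from this(2,1) show "x \<in> group_closure Y"
    by induction (auto intro: group_closure.diff)
qed

lemma monoid_closure_subset_group_closure: "monoid_closure X \<subseteq> group_closure X"
proof
  fix x assume "x \<in> monoid_closure X"
  then show "x \<in> group_closure X"
    by induction (auto intro: group_closure_add group_closure.base)
qed

lemma group_closure_monoid_closure: "group_closure (monoid_closure X) = group_closure X"
  using group_closure_mono[OF monoid_closure_subset_group_closure, of X]
    group_closure_mono[of X "monoid_closure X"]
  by (auto intro: group_closure.base monoid_closure.base)

lemma group_closure_eq_sum:
  fixes x :: "int ^ 'n::finite"
  assumes "finite F" "x \<in> group_closure F"
  shows "\<exists>k. x = (\<Sum>b\<in>F. k b *s b)"
  using assms(2)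
proof induction
  case (base x)
  show ?case
  proof (cases "x = 0")
    case True
    then show ?thesis by (intro exI[of _ "\<lambda>_. 0"]) simp
  next
    case False
    have "(\<Sum>b\<in>F. (if b = x then 1 else 0) *s b) = (\<Sum>b\<in>F. if b = x then x else 0)"
      by (rule sum.cong) auto
    also have "\<dots> = x" using base False assms(1) by simp
    finally show ?thesis by (intro exI[of _ "\<lambda>b. if b = x then 1 else 0"]) simp
  qed
next
  case (diff x y)
  then obtain k l where "x = (\<Sum>b\<in>F. k b *s b)" "y = (\<Sum>b\<in>F. l b *s b)" by blast
  then have "x - y = (\<Sum>b\<in>F. (k b - l b) *s b)"
    by (simp add: sum_subtractf[symmetric] vec_eq_iff algebra_simps)
  then show ?case by (intro exI[of _ "\<lambda>b. k b - l b"])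
qed

lemma common_denominator:
  fixes c :: "'i \<Rightarrow> rat"
  assumes "finite I" "\<And>i. i \<in> I \<Longrightarrow> 0 \<le> c i"
  shows "\<exists>N > 0. \<forall>i\<in>I. \<exists>m. rat_of_nat N * c i = rat_of_nat m"
  using assms
proof (induction I)
  case empty
  show ?case by (auto intro: exI[of _ 1])
next
  case (insert j I)
  then obtain N where N: "N > 0" "\<forall>i\<in>I. \<exists>m. rat_of_nat N * c i = rat_of_nat m" by auto
  obtain p q where pq: "c j = Fract p q" "q > 0" by (cases "c j")
  have "p \<ge> 0" using insert.prems[of j] pq by (simp add: zero_le_Fract_iff)
  have q: "rat_of_nat (nat q) * c j = rat_of_nat (nat p)"
    using pq \<open>p \<ge> 0\<close> by (simp add: Fract_of_int_quotient)
  show ?case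
  proof (rule exI[of _ "N * nat q"], intro conjI ballI)
    show "N * nat q > 0" using N pq by simp
    fix i assume "i \<in> insert j I"
    then show "\<exists>m. rat_of_nat (N * nat q) * c i = rat_of_nat m"
    proof
      assume "i = j"
      then show ?thesis using q by (intro exI[of _ "N * nat p"]) (simp add: mult.assoc)
    next
      assume "i \<in> I"
      then obtain m where "rat_of_nat N * c i = rat_of_nat m" using N by blast
      then show ?thesis by (intro exI[of _ "nat q * m"]) (simp add: ac_simps)
    qed
  qed
qed

lemma simplicial_multiple:
  fixes B :: "(int ^ 'n::finite) set"
  assumes "simplicial_by B d e" "b \<in> B"
  shows "\<exists>N > 0. int N *s b \<in> monoid_closure (e ` {1..d})"
proof -
  have "rat_vec b = (\<Sum>x\<in>{rat_vec b}. 1 *s x)" by simp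
  then have "rat_vec b \<in> rat_cone (rat_vec ` B)"
    unfolding rat_cone_def using assms(2)
    by (intro CollectI exI[of _ "{rat_vec b}"] exI[of _ "\<lambda>_. 1"]) auto
  then have "rat_vec b \<in> rat_cone (rat_vec ` e ` {1..d})"
    using assms(1) by (simp add: simplicial_by_def)
  then obtain F c where F: "finite F" "F \<subseteq> rat_vec ` e ` {1..d}" "\<forall>x\<in>F. 0 \<le> c x"
      "rat_vec b = (\<Sum>x\<in>F. c x *s x)"
    unfolding rat_cone_def by blast
  obtain E where E: "E \<subseteq> e ` {1..d}" "F = rat_vec ` E"
    using F(2) by (auto simp: subset_image_iff)
  have inj: "inj_on rat_vec E" by (auto simp: inj_on_def rat_vec_eq_iff)
  obtain N where N: "N > 0" "\<forall>x\<in>F. \<exists>m. rat_of_nat N * c x = rat_of_nat m"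
    using common_denominator[of F c] F by auto
  then obtain m where m: "\<And>x. x \<in> F \<Longrightarrow> rat_of_nat N * c x = rat_of_nat (m x)" by metis
  have "rat_vec (int N *s b) = (\<Sum>x\<in>F. (rat_of_nat N * c x) *s x)"
    by (simp add: rat_vec_smult F(4) vec.scale_sum_right)
  also have "\<dots> = (\<Sum>x\<in>F. rat_of_nat (m x) *s x)"
    by (intro sum.cong) (auto simp: m)
  also have "\<dots> = (\<Sum>x\<in>E. rat_of_nat (m (rat_vec x)) *s rat_vec x)"
    unfolding E(2) by (subst sum.reindex[OF inj]) simp
  also have "\<dots> = rat_vec (\<Sum>x\<in>E. int (m (rat_vec x)) *s x)"
    by (simp add: rat_vec_sum rat_vec_smult)
  finally have "int N *s b = (\<Sum>x\<in>E. int (m (rat_vec x)) *s x)"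
    by (simp add: rat_vec_eq_iff)
  also have "\<dots> \<in> monoid_closure (e ` {1..d})"
    using E(1) by (intro monoid_closure_sum monoid_closure_smult monoid_closure.base) auto
  finally show ?thesis using N(1) by blast
qed

lemma finite_minimal_elements:
  fixes B :: "(int ^ 'n::finite) set"
  assumes "affine_semigroup B" "simplicial_by B d e"
  shows "finite (minimal_elements B (monoid_closure (e ` {1..d})))"
proof -
  let ?A = "monoid_closure (e ` {1..d})"
  obtain F where F: "finite F" "B = monoid_closure F"
    using assms(1) by (auto simp: affine_semigroup_def)
  have "\<exists>N > 0. int N *s b \<in> ?A" if "b \<in> F" for b
    using simplicial_multiple[OF assms(2)] F(2) that by (blast intro: monoid_closure.base)
  then obtain N where N: "\<And>b. b \<in> F \<Longrightarrow> N b > 0 \<and> int (N b) *s b \<in> ?A" by metis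
  define P where "P = (\<Pi>\<^sub>E b\<in>F - {0}. {..<N b})"
  have "finite P" unfolding P_def using F(1) by (intro finite_PiE) auto
  moreover have "minimal_elements B ?A \<subseteq> (\<lambda>k. \<Sum>b\<in>F - {0}. int (k b) *s b) ` P"
  proof
    fix x assume x: "x \<in> minimal_elements B ?A"
    then obtain k where k: "x = (\<Sum>b\<in>F. int (k b) *s b)"
      using monoid_closure_eq_sum[OF F(1), of x] F(2) by (auto simp: minimal_elements_def)
    have "k b < N b" if b: "b \<in> F - {0}" for b
    proof (rule ccontr)
      assume "\<not> k b < N b"
      then have le: "N b \<le> k b" by simp
      have "x - int (N b) *s b = int (k b - N b) *s b + (\<Sum>b\<in>F - {b}. int (k b) *s b)"
        using k b F(1) le by (simp add: sum.remove[of F b] vec_eq_iff of_nat_diff algebra_simps)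
      also have "\<dots> \<in> B"
        unfolding F(2) using b
        by (intro monoid_closure.add monoid_closure_sum monoid_closure_smult)
           (auto intro: monoid_closure.base)
      finally have "x - int (N b) *s b \<in> B" .
      moreover have "int (N b) *s b \<noteq> 0" using N[of b] b by (auto simp: vec_eq_iff)
      ultimately show False using x N[of b] b by (auto simp: minimal_elements_def)
    qed
    then have "restrict k (F - {0}) \<in> P" by (auto simp: P_def)
    moreover have "x = (\<Sum>b\<in>F - {0}. int (restrict k (F - {0}) b) *s b)"
      unfolding k using F(1) by (intro sum.mono_neutral_cong_right) auto
    ultimately show "x \<in> (\<lambda>k. \<Sum>b\<in>F - {0}. int (k b) *s b) ` P" by blast
  qed
  ultimately show ?thesis by (meson finite_imageI finite_subset)
qed

lemma finite_minimal_classes: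
  fixes B :: "(int ^ 'n::finite) set"
  assumes "affine_semigroup B" "simplicial_by B d e"
  shows "finite (minimal_classes B (monoid_closure (e ` {1..d})))"
  unfolding minimal_classes_def quotient_def
  using finite_minimal_elements[OF assms] by simp

lemma coord_unique:
  fixes B :: "(int ^ 'n::finite) set"
  assumes "simplicial_by B d e" "rat_vec x = (\<Sum>i = 1..d. c i *s rat_vec (e i))" "i \<in> {1..d}"
  shows "coord d e x i = c i"
proof -
  let ?E = "rat_vec ` e ` {1..d}"
  have inj: "inj_on (\<lambda>i. rat_vec (e i)) {1..d}"
    using assms(1) unfolding simplicial_by_def inj_on_def rat_vec_eq_iff by blast
  have ind: "vec.independent ?E" using assms(1) by (simp add: simplicial_by_def)
  define f where "f v = (if v \<in> ?E then c (the_inv_into {1..d} (\<lambda>i. rat_vec (e i)) v) else 0)" for v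
  have f: "f (rat_vec (e i)) = c i" if "i \<in> {1..d}" for i
    using that the_inv_into_f_f[OF inj that] by (auto simp: f_def)
  have "vec.representation ?E (rat_vec x) = f"
  proof (rule vec.representation_eqI[OF ind])
    show "rat_vec x \<in> vec.span ?E"
      unfolding assms(2) by (intro vec.span_sum vec.span_scale vec.span_base) auto
    show "b \<in> ?E" if "f b \<noteq> 0" for b using that by (auto simp: f_def split: if_splits)
    then have sub: "{b. f b \<noteq> 0} \<subseteq> ?E" by auto
    then show "finite {b. f b \<noteq> 0}" by (rule finite_subset) simp
    have "(\<Sum>b | f b \<noteq> 0. f b *s b) = (\<Sum>b\<in>?E. f b *s b)"
      using sub by (intro sum.mono_neutral_left) auto
    also have "\<dots> = (\<Sum>b\<in>(\<lambda>i. rat_vec (e i)) ` {1..d}. f b *s b)"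
      by (simp add: image_image)
    also have "\<dots> = (\<Sum>i = 1..d. c i *s rat_vec (e i))"
      by (subst sum.reindex[OF inj]) (auto simp: f intro!: sum.cong)
    finally show "(\<Sum>b | f b \<noteq> 0. f b *s b) = rat_vec x" using assms(2) by simp
  qed
  then show ?thesis using f assms(3) by (simp add: coord_def)
qed

lemma rat_vec_eq_coord_sum:
  fixes B :: "(int ^ 'n::finite) set"
  assumes "simplicial_by B d e" "x \<in> group_closure B"
  shows "rat_vec x = (\<Sum>i = 1..d. coord d e x i *s rat_vec (e i))"
proof -
  let ?E = "rat_vec ` e ` {1..d}"
  have inj: "inj_on (\<lambda>i. rat_vec (e i)) {1..d}"
    using assms(1) unfolding simplicial_by_def inj_on_def rat_vec_eq_iff by blast
  have B: "rat_vec b \<in> vec.span ?E" if b: "b \<in> B" for b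
  proof -
    obtain N where N: "N > 0" "int N *s b \<in> monoid_closure (e ` {1..d})"
      using simplicial_multiple[OF assms(1) b] by blast
    have "rat_vec a \<in> vec.span ?E" if "a \<in> monoid_closure (e ` {1..d})" for a
      using that by induction
        (auto simp: rat_vec_0 rat_vec_add intro: vec.span_zero vec.span_add vec.span_base)
    then have "rat_of_nat N *s rat_vec b \<in> vec.span ?E"
      using N(2) rat_vec_smult[of "int N" b] by (metis of_int_of_nat_eq)
    then have "inverse (rat_of_nat N) *s (rat_of_nat N *s rat_vec b) \<in> vec.span ?E"
      by (rule vec.span_scale)
    then show ?thesis using N(1) by simp
  qed
  have "rat_vec x \<in> vec.span ?E"
    using assms(2)
    by induction (auto simp: rat_vec_0 rat_vec_diff B simp del: One_nat_def
        intro: vec.span_zero vec.span_diff)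
  then have "(\<Sum>b\<in>?E. vec.representation ?E (rat_vec x) b *s b) = rat_vec x"
    using assms(1) by (intro vec.sum_representation_eq) (auto simp: simplicial_by_def)
  then have "rat_vec x = (\<Sum>b\<in>(\<lambda>i. rat_vec (e i)) ` {1..d}. vec.representation ?E (rat_vec x) b *s b)"
    by (simp add: image_image)
  then show ?thesis
    by (subst (asm) sum.reindex[OF inj]) (simp add: coord_def)
qed

lemma h_vec_aux:
  fixes B :: "(int ^ 'n::finite) set"
  assumes "affine_semigroup B" "simplicial_by B d e"
    and "\<Gamma> \<in> minimal_classes B (monoid_closure (e ` {1..d}))"
  shows "\<exists>h \<in> group_closure B. rat_vec h =
           (\<Sum>i = 1..d. Min ((\<lambda>x. coord d e x i) ` \<Gamma>) *s rat_vec (e i))"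
proof -
  let ?A = "monoid_closure (e ` {1..d})"
  have inje: "inj_on e {1..d}" and eB: "e ` {1..d} \<subseteq> B"
    using assms(2) by (auto simp: simplicial_by_def)
  obtain x where x: "x \<in> minimal_elements B ?A"
    and \<Gamma>: "\<Gamma> = {y \<in> minimal_elements B ?A. x - y \<in> group_closure ?A}"
    using assms(3) by (auto simp: minimal_classes_def quotient_def)
  have "x \<in> \<Gamma>" using x by (simp add: \<Gamma>)
  have "finite \<Gamma>" using finite_minimal_elements[OF assms(1,2)] by (simp add: \<Gamma>)
  have xB: "x \<in> group_closure B"
    using x by (auto simp: minimal_elements_def intro: group_closure.base)
  have int: "\<exists>k. \<forall>i\<in>{1..d}. coord d e y i = coord d e x i - rat_of_int (k i)" if y: "y \<in> \<Gamma>" for y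
  proof -
    have "x - y \<in> group_closure (e ` {1..d})"
      using y by (simp add: \<Gamma> group_closure_monoid_closure)
    then obtain k where k: "x - y = (\<Sum>b\<in>e ` {1..d}. k b *s b)"
      using group_closure_eq_sum[of "e ` {1..d}"] by auto
    then have "x - y = (\<Sum>i = 1..d. k (e i) *s e i)"
      by (subst (asm) sum.reindex[OF inje]) simp
    then have "rat_vec x - rat_vec y = (\<Sum>i = 1..d. rat_of_int (k (e i)) *s rat_vec (e i))"
      by (metis (no_types, lifting) rat_vec_diff rat_vec_sum rat_vec_smult sum.cong)
    then have "rat_vec y = rat_vec x - (\<Sum>i = 1..d. rat_of_int (k (e i)) *s rat_vec (e i))"
      by (simp add: algebra_simps)
    also have "\<dots> = (\<Sum>i = 1..d. (coord d e x i - rat_of_int (k (e i))) *s rat_vec (e i))"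
      by (subst rat_vec_eq_coord_sum[OF assms(2) xB])
         (simp add: sum_subtractf[symmetric] vec.scale_left_diff_distrib)
    finally have "\<forall>i\<in>{1..d}. coord d e y i = coord d e x i - rat_of_int (k (e i))"
      using coord_unique[OF assms(2), of y "\<lambda>i. coord d e x i - rat_of_int (k (e i))"] by simp
    then show ?thesis by (intro exI[of _ "\<lambda>i. k (e i)"])
  qed
  have "\<exists>m. Min ((\<lambda>x. coord d e x i) ` \<Gamma>) = coord d e x i - rat_of_int m" if i: "i \<in> {1..d}" for i
  proof -
    have "Min ((\<lambda>x. coord d e x i) ` \<Gamma>) \<in> (\<lambda>x. coord d e x i) ` \<Gamma>"
      using \<open>finite \<Gamma>\<close> \<open>x \<in> \<Gamma>\<close> by (intro Min_in) auto
    then obtain y where "y \<in> \<Gamma>" "Min ((\<lambda>x. coord d e x i) ` \<Gamma>) = coord d e y i" by blast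
    then show ?thesis using int[of y] i by metis
  qed
  then obtain m where m:
    "\<And>i. i \<in> {1..d} \<Longrightarrow> Min ((\<lambda>x. coord d e x i) ` \<Gamma>) = coord d e x i - rat_of_int (m i)"
    by metis
  let ?h = "x - (\<Sum>i = 1..d. m i *s e i)"
  have "rat_vec ?h = (\<Sum>i = 1..d. (coord d e x i - rat_of_int (m i)) *s rat_vec (e i))"
    unfolding rat_vec_diff rat_vec_sum rat_vec_smult
    by (subst rat_vec_eq_coord_sum[OF assms(2) xB])
       (simp add: sum_subtractf[symmetric] vec.scale_left_diff_distrib)
  also have "\<dots> = (\<Sum>i = 1..d. Min ((\<lambda>x. coord d e x i) ` \<Gamma>) *s rat_vec (e i))"
    by (rule sum.cong) (auto simp: m)
  finally have "rat_vec ?h = \<dots>" .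
  moreover have "?h \<in> group_closure B"
    using eB
    by (intro group_closure.diff xB group_closure_sum group_closure_smult group_closure.base)
       (auto simp: image_subset_iff)
  ultimately show ?thesis by blast
qed

lemma rat_vec_h_vec:
  fixes B :: "(int ^ 'n::finite) set"
  assumes "affine_semigroup B" "simplicial_by B d e"
    and "\<Gamma> \<in> minimal_classes B (monoid_closure (e ` {1..d}))"
  shows "rat_vec (h_vec d e \<Gamma>) = (\<Sum>i = 1..d. Min ((\<lambda>x. coord d e x i) ` \<Gamma>) *s rat_vec (e i))"
  unfolding h_vec_def
  by (rule theI') (use h_vec_aux[OF assms] in \<open>auto simp flip: rat_vec_eq_iff\<close>)

lemma h_vec_in_group_closure:
  fixes B :: "(int ^ 'n::finite) set"
  assumes "affine_semigroup B" "simplicial_by B d e"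
    and "\<Gamma> \<in> minimal_classes B (monoid_closure (e ` {1..d}))"
  shows "h_vec d e \<Gamma> \<in> group_closure B"
  using h_vec_aux[OF assms] rat_vec_h_vec[OF assms] by (metis rat_vec_eq_iff)



section \<open>Graded rings and modules\<close>

record ('g, 'a) graded_ring = "'a ring" +
  ring_component :: "'g \<Rightarrow> 'a set"

record ('g, 'a, 'b) graded_module = "('a, 'b) module" +
  component :: "'g \<Rightarrow> 'b set"

definition internal_direct_sum :: "('b, 'm) ring_scheme \<Rightarrow> ('g \<Rightarrow> 'b set) \<Rightarrow> bool" where
  "internal_direct_sum M C \<longleftrightarrow>
     (\<forall>g. additive_subgroup (C g) M) \<and>
     (\<forall>m \<in> carrier M. \<exists>!c. (\<forall>g. c g \<in> C g) \<and> finite {g. c g \<noteq> \<zero>\<^bsub>M\<^esub>} \<and>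
        m = finsum M c {g. c g \<noteq> \<zero>\<^bsub>M\<^esub>})"

definition is_graded_ring :: "('g::ab_group_add, 'a) graded_ring \<Rightarrow> bool" where
  "is_graded_ring R \<longleftrightarrow>
     cring R \<and> internal_direct_sum R (ring_component R) \<and>
     (\<forall>g h. \<forall>a \<in> ring_component R g. \<forall>b \<in> ring_component R h.
        a \<otimes>\<^bsub>R\<^esub> b \<in> ring_component R (g + h))"

definition is_graded_module ::
    "('g::ab_group_add, 'a) graded_ring \<Rightarrow> ('g, 'a, 'b) graded_module \<Rightarrow> bool" where
  "is_graded_module R M \<longleftrightarrow>
     is_graded_ring R \<and> Module.module R M \<and> internal_direct_sum M (component M) \<and>
     (\<forall>g h. \<forall>a \<in> ring_component R g. \<forall>m \<in> component M h.
        a \<odot>\<^bsub>M\<^esub> m \<in> component M (g + h))"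

definition graded_module_iso ::
    "('g, 'a) graded_ring \<Rightarrow> ('g, 'a, 'b) graded_module \<Rightarrow> ('g, 'a, 'c) graded_module \<Rightarrow>
     ('b \<Rightarrow> 'c) set" where
  "graded_module_iso R M N = {\<phi>.
     bij_betw \<phi> (carrier M) (carrier N) \<and>
     (\<forall>x \<in> carrier M. \<forall>y \<in> carrier M. \<phi> (x \<oplus>\<^bsub>M\<^esub> y) = \<phi> x \<oplus>\<^bsub>N\<^esub> \<phi> y) \<and>
     (\<forall>a \<in> carrier R. \<forall>x \<in> carrier M. \<phi> (a \<odot>\<^bsub>M\<^esub> x) = a \<odot>\<^bsub>N\<^esub> \<phi> x) \<and>
     (\<forall>g. \<phi> ` component M g = component N g)}"

definition graded_isomorphic ::
    "('g::ab_group_add, 'a) graded_ring \<Rightarrow> ('g, 'a, 'b) graded_module \<Rightarrow>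
     ('g, 'a, 'c) graded_module \<Rightarrow> bool" where
  "graded_isomorphic R M N \<longleftrightarrow>
     is_graded_module R M \<and> is_graded_module R N \<and> graded_module_iso R M N \<noteq> {}"

text \<open>The twist \<open>M(h)\<close>, with \<open>M(h)\<^sub>g = M\<^sub>g\<^sub>+\<^sub>h\<close>.\<close>

definition twist ::
    "('g::ab_group_add, 'a, 'b) graded_module \<Rightarrow> 'g \<Rightarrow> ('g, 'a, 'b) graded_module" where
  "twist M h = M\<lparr>component := (\<lambda>g. component M (g + h))\<rparr>"

text \<open>The records for modules carry the fields \<open>mult\<close> and \<open>one\<close>, which play no role for
  modules.\<close>

definition graded_direct_sum ::
    "'i set \<Rightarrow> ('i \<Rightarrow> ('g, 'a, 'b) graded_module) \<Rightarrow> ('g, 'a, 'i \<Rightarrow> 'b) graded_module" where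
  "graded_direct_sum I M =
     \<lparr>carrier = {x \<in> \<Pi>\<^sub>E i\<in>I. carrier (M i). finite {i \<in> I. x i \<noteq> \<zero>\<^bsub>M i\<^esub>}},
      mult = (\<lambda>x y. \<lambda>i\<in>I. x i \<otimes>\<^bsub>M i\<^esub> y i),
      one = (\<lambda>i\<in>I. \<one>\<^bsub>M i\<^esub>),
      zero = (\<lambda>i\<in>I. \<zero>\<^bsub>M i\<^esub>),
      add = (\<lambda>x y. \<lambda>i\<in>I. x i \<oplus>\<^bsub>M i\<^esub> y i),
      smult = (\<lambda>a x. \<lambda>i\<in>I. a \<odot>\<^bsub>M i\<^esub> x i),
      component = (\<lambda>g. {x \<in> \<Pi>\<^sub>E i\<in>I. component (M i) g. finite {i \<in> I. x i \<noteq> \<zero>\<^bsub>M i\<^esub>}})\<rparr>"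


section \<open>Semigroup rings\<close>

text \<open>The type \<open>'g \<Rightarrow>\<^sub>0 'k\<close> of finitely supported functions with the convolution product is
  the group ring of \<open>'g\<close>, with \<open>Poly_Mapping.single s 1\<close> in the role of \<open>t\<^sup>s\<close>; the semigroup ring
  of \<open>S\<close> is the subring of elements supported in \<open>S\<close>.\<close>

definition sg_carrier :: "'k::field itself \<Rightarrow> 'g::ab_group_add set \<Rightarrow> ('g \<Rightarrow>\<^sub>0 'k) set" where
  "sg_carrier _ S = {p. Poly_Mapping.keys p \<subseteq> S}"

definition sg_component ::
    "'k::field itself \<Rightarrow> 'g::ab_group_add set \<Rightarrow> 'g \<Rightarrow> ('g \<Rightarrow>\<^sub>0 'k) set" where
  "sg_component K S g = {p \<in> sg_carrier K S. Poly_Mapping.keys p \<subseteq> {g}}"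

definition semigroup_ring ::
    "'k::field itself \<Rightarrow> 'g::ab_group_add set \<Rightarrow> ('g, 'g \<Rightarrow>\<^sub>0 'k) graded_ring" where
  "semigroup_ring K S =
     \<lparr>carrier = sg_carrier K S, mult = (*), one = 1, zero = 0, add = (+),
      ring_component = sg_component K S\<rparr>"

text \<open>The semigroup ring of \<open>S\<close> as a module, via multiplication, over the semigroup ring of any
  submonoid of \<open>S\<close> (in particular over itself).\<close>

definition semigroup_module ::
    "'k::field itself \<Rightarrow> 'g::ab_group_add set \<Rightarrow> ('g, 'g \<Rightarrow>\<^sub>0 'k, 'g \<Rightarrow>\<^sub>0 'k) graded_module" where
  "semigroup_module K S =
     \<lparr>carrier = sg_carrier K S, mult = (*), one = 1, zero = 0, add = (+),
      smult = (*), component = sg_component K S\<rparr>"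

end

theory Submission
  imports Defs
begin

text \<open>
  The monoid \<open>\<langle>e\<^sub>1, \<dots>, e\<^sub>d, h\<^sub>1, \<dots>, h\<^sub>f\<rangle>\<close> is the disjoint union of the translates \<open>h\<^sub>j + A\<close>, and
  each translate contributes a free summand \<open>T(-h\<^sub>j)\<close>. The union is disjoint because \<open>h\<^sub>j\<close> is congruent
  to the elements of \<open>\<Gamma>\<^sub>j\<close> modulo \<open>G(A)\<close>. It is closed under addition: for \<open>x \<in> \<Gamma>\<^sub>j\<close>, \<open>y \<in> \<Gamma>\<^sub>k\<close> one
  can write \<open>x + y = z + a\<close> with \<open>a \<in> A\<close> and \<open>z\<close> minimal, and the class \<open>\<Gamma>\<^sub>l\<close> of \<open>z\<close> depends only on \<open>j\<close>
  and \<open>k\<close>. Choosing \<open>x\<close> and \<open>y\<close> with minimal \<open>i\<close>-th coordinate, separately for each \<open>i\<close>, shows that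
  \<open>h\<^sub>j + h\<^sub>k - h\<^sub>l\<close> has nonnegative coordinates, so it lies in \<open>A\<close>.
\<close>

section \<open>Simplicial affine semigroups\<close>

lemma group_closure_member: "x \<in> X \<Longrightarrow> x \<in> group_closure X"
  by (auto intro: group_closure.base)

locale simplicial_semigroup =
  fixes B :: "(int ^ 'n::finite) set" and d :: nat and e :: "nat \<Rightarrow> int ^ 'n"
  assumes affine: "affine_semigroup B" and simplicial: "simplicial_by B d e"
begin

abbreviation A :: "(int ^ 'n) set" where "A \<equiv> monoid_closure (e ` {1..d})"
abbreviation \<Lambda> :: "int ^ 'n \<Rightarrow> nat \<Rightarrow> rat" where "\<Lambda> \<equiv> coord d e"
abbreviation min_classes :: "(int ^ 'n) set set" where "min_classes \<equiv> minimal_classes B A"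
abbreviation h :: "(int ^ 'n) set \<Rightarrow> int ^ 'n" where "h \<equiv> h_vec d e"

declare One_nat_def [simp del]

section \<open>The monoid \<open>A\<close> inside \<open>B\<close>, and rational coordinates\<close>

lemma zero_in_B: "0 \<in> B" and add_in_B: "x \<in> B \<Longrightarrow> y \<in> B \<Longrightarrow> x + y \<in> B"
  using affine by (auto simp: affine_semigroup_def intro: monoid_closure.intros)

lemma A_subset_B: "A \<subseteq> B"
proof
  fix x assume "x \<in> A"
  then show "x \<in> B"
    by induction (use simplicial in \<open>auto simp: simplicial_by_def intro: zero_in_B add_in_B\<close>)
qed

lemma group_A_subset: "group_closure A \<subseteq> group_closure B"
  using A_subset_B by (intro group_closure_mono) (auto intro: group_closure_member)

lemma group_A_eq_sum:
  assumes "x \<in> group_closure A"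
  obtains k where "x = (\<Sum>i = 1..d. k i *s e i)"
proof -
  have inj: "inj_on e {1..d}" using simplicial by (simp add: simplicial_by_def)
  obtain k where "x = (\<Sum>b\<in>e ` {1..d}. k b *s b)"
    using group_closure_eq_sum[of "e ` {1..d}" x] assms
    by (auto simp: group_closure_monoid_closure)
  then have "x = (\<Sum>i = 1..d. k (e i) *s e i)"
    by (subst (asm) sum.reindex[OF inj]) simp
  then show ?thesis by (rule that)
qed

lemma coord_int_sum:
  assumes "i \<in> {1..d}"
  shows "\<Lambda> (\<Sum>i = 1..d. k i *s e i) i = of_int (k i)"
  by (rule coord_unique[OF simplicial _ assms]) (simp add: rat_vec_sum rat_vec_smult)

text \<open>\<open>coord\<close> rests on \<open>vec.representation\<close>, which is zero on
  vectors outside the span of the \<open>e i\<close>. Membership in \<open>group_closure B\<close>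
  puts both vectors into that span, where uniqueness of coordinates gives additivity.\<close>

lemma coord_add:
  assumes "x \<in> group_closure B" "y \<in> group_closure B" "i \<in> {1..d}"
  shows "\<Lambda> (x + y) i = \<Lambda> x i + \<Lambda> y i"
proof (rule coord_unique[OF simplicial _ assms(3)])
  show "rat_vec (x + y) = (\<Sum>i = 1..d. (\<Lambda> x i + \<Lambda> y i) *s rat_vec (e i))"
    unfolding rat_vec_add
    by (subst (1) rat_vec_eq_coord_sum[OF simplicial assms(1)],
        subst (1) rat_vec_eq_coord_sum[OF simplicial assms(2)])
       (simp add: sum.distrib vec.scale_left_distrib)
qed

lemma coord_diff:
  assumes "x \<in> group_closure B" "y \<in> group_closure B" "i \<in> {1..d}"
  shows "\<Lambda> (x - y) i = \<Lambda> x i - \<Lambda> y i"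
  using coord_add[OF group_closure.diff[OF assms(1,2)] assms(2,3)] by simp

lemma eq_if_coord_eq:
  assumes "x \<in> group_closure B" "y \<in> group_closure B" "\<And>i. i \<in> {1..d} \<Longrightarrow> \<Lambda> x i = \<Lambda> y i"
  shows "x = y"
proof -
  have "rat_vec x = rat_vec y"
    using assms(3)
    by (subst (1) rat_vec_eq_coord_sum[OF simplicial assms(1)],
        subst (1) rat_vec_eq_coord_sum[OF simplicial assms(2)]) simp
  then show ?thesis by (simp add: rat_vec_eq_iff)
qed

lemma coord_group_A_in_Ints:
  assumes "x \<in> group_closure A" "i \<in> {1..d}"
  shows "\<Lambda> x i \<in> \<int>"
  using group_A_eq_sum[OF assms(1)] coord_int_sum[OF assms(2)] by (metis Ints_of_int)

text \<open>Coordinates determine an element of \<open>group_closure B\<close>, so integral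
  coordinates force it to equal the corresponding integer combination of the
  \<open>e i\<close>.\<close>

lemma in_group_A_iff:
  assumes "x \<in> group_closure B"
  shows "x \<in> group_closure A \<longleftrightarrow> (\<forall>i\<in>{1..d}. \<Lambda> x i \<in> \<int>)"
proof
  assume "\<forall>i\<in>{1..d}. \<Lambda> x i \<in> \<int>"
  then obtain k where k: "\<And>i. i \<in> {1..d} \<Longrightarrow> \<Lambda> x i = of_int (k i)"
    unfolding Ints_def image_iff by metis
  have *: "(\<Sum>i = 1..d. k i *s e i) \<in> group_closure A"
    by (intro group_closure_sum group_closure_smult group_closure_member) (auto intro: monoid_closure.base)
  have "x = (\<Sum>i = 1..d. k i *s e i)"
    by (rule eq_if_coord_eq[OF assms]) (use * group_A_subset k coord_int_sum in auto)
  with * show "x \<in> group_closure A" by simp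
qed (use coord_group_A_in_Ints in blast)

lemma coord_A_nonneg:
  assumes "x \<in> A" "i \<in> {1..d}"
  shows "0 \<le> \<Lambda> x i"
  using assms(1)
proof induction
  case zero
  show ?case using coord_diff[of 0 0 i] assms(2) by simp
next
  case (base x)
  then obtain j where j: "j \<in> {1..d}" "x = e j" by blast
  \<comment> \<open>By uniqueness, the coordinates of the generator \<open>e j\<close> form the
    Kronecker delta at \<open>j\<close>.\<close>
  have "\<Lambda> x i = of_bool (i = j)"
  proof (rule coord_unique[OF simplicial _ assms(2)])
    have "(\<Sum>i = 1..d. of_bool (i = j) *s rat_vec (e i)) = (\<Sum>i = 1..d. if i = j then rat_vec (e i) else 0)"
      by (rule sum.cong) auto
    then show "rat_vec x = (\<Sum>i = 1..d. of_bool (i = j) *s rat_vec (e i))"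
      using j by simp
  qed
  then show ?case by simp
next
  case (add x y)
  have "A \<subseteq> group_closure B" using A_subset_B group_closure_member by blast
  then show ?case using add assms(2) by (simp add: coord_add subset_iff)
qed

text \<open>The cones of \<open>B\<close> and of the \<open>e i\<close> coincide, so a positive
  multiple of \<open>x\<close> lies in \<open>A\<close>; dividing by the positive factor keeps the
  sign of the coordinates.\<close>

lemma coord_B_nonneg:
  assumes "x \<in> B" "i \<in> {1..d}"
  shows "0 \<le> \<Lambda> x i"
proof -
  obtain N where N: "N > 0" "int N *s x \<in> A"
    using simplicial_multiple[OF simplicial assms(1)] by blast
  have "\<Lambda> (int N *s x) i = of_nat N * \<Lambda> x i"
  proof (rule coord_unique[OF simplicial _ assms(2)])
    have "rat_vec x = (\<Sum>i = 1..d. \<Lambda> x i *s rat_vec (e i))"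
      by (intro rat_vec_eq_coord_sum[OF simplicial] group_closure_member assms)
    then have "rat_vec (int N *s x) = of_nat N *s (\<Sum>i = 1..d. \<Lambda> x i *s rat_vec (e i))"
      by (simp add: rat_vec_smult)
    then show "rat_vec (int N *s x) = (\<Sum>i = 1..d. (of_nat N * \<Lambda> x i) *s rat_vec (e i))"
      by (simp add: vec.scale_sum_right)
  qed
  with coord_A_nonneg[OF N(2) assms(2)] N(1) show ?thesis
    by (simp add: zero_le_mult_iff)
qed

text \<open>The coordinates of an element of \<open>group_closure A\<close> are its integer
  coefficients; once these are nonnegative, the element is a combination over the natural
  numbers.\<close>

lemma in_A_if_coord_nonneg:
  assumes "x \<in> group_closure A" "\<And>i. i \<in> {1..d} \<Longrightarrow> 0 \<le> \<Lambda> x i"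
  shows "x \<in> A"
proof -
  obtain k where k: "x = (\<Sum>i = 1..d. k i *s e i)" using group_A_eq_sum[OF assms(1)] .
  have "0 \<le> k i" if "i \<in> {1..d}" for i
    using assms(2)[OF that] coord_int_sum[OF that, of k] k by simp
  then have "x = (\<Sum>i = 1..d. int (nat (k i)) *s e i)"
    unfolding k by (intro sum.cong) auto
  also have "\<dots> \<in> A"
    by (intro monoid_closure_sum monoid_closure_smult monoid_closure.base) auto
  finally show ?thesis .
qed

section \<open>Descent to minimal elements\<close>

lemma coord_sum_ge_1:
  assumes "a \<in> A" "a \<noteq> 0"
  shows "1 \<le> (\<Sum>i = 1..d. \<Lambda> a i)"
proof -
  have aA: "a \<in> group_closure A" using assms(1) by (rule group_closure_member)
  then have aB: "a \<in> group_closure B" using group_A_subset by blast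
  have nn: "0 \<le> \<Lambda> a i" if "i \<in> {1..d}" for i using coord_A_nonneg[OF assms(1) that] .
  \<comment> \<open>If all coordinates vanished, \<open>a\<close> would be \<open>0\<close>. A
    nonzero coordinate is a nonnegative integer, hence at least 1.\<close>
  obtain i where i: "i \<in> {1..d}" "\<Lambda> a i \<noteq> 0"
  proof (rule ccontr)
    assume "\<not> thesis"
    then have "\<And>i. i \<in> {1..d} \<Longrightarrow> \<Lambda> a i = \<Lambda> 0 i"
      using that coord_diff[of 0 0] by fastforce
    then have "a = 0" by (intro eq_if_coord_eq aB) auto
    with assms(2) show False by simp
  qed
  obtain k :: int where k: "\<Lambda> a i = of_int k" using coord_group_A_in_Ints[OF aA i(1)] by (auto elim: Ints_cases)
  have "1 \<le> \<Lambda> a i" using nn[OF i(1)] i(2) unfolding k by simp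
  also have "\<dots> \<le> (\<Sum>i = 1..d. \<Lambda> a i)" using i(1) nn by (intro member_le_sum) auto
  finally show ?thesis .
qed

text \<open>Nonzero elements of \<open>A\<close> are subtracted as long as the result stays in
  \<open>B\<close>. Each step lowers the coordinate sum by at least 1, while the sum stays
  nonnegative on \<open>B\<close>. The sum is only rational, so its floor serves as the terminating
  measure.\<close>

lemma exists_minimal_below:
  assumes "x \<in> B"
  shows "\<exists>z \<in> minimal_elements B A. x - z \<in> A"
  using assms
proof (induction "nat \<lfloor>\<Sum>i = 1..d. \<Lambda> x i\<rfloor>" arbitrary: x rule: less_induct)
  case less
  show ?case
  proof (cases "x \<in> minimal_elements B A")
    case True
    then show ?thesis by (intro bexI[of _ x]) (auto intro: monoid_closure.zero)
  next
    case False
    then obtain a where a: "a \<in> A" "a \<noteq> 0" "x - a \<in> B"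
      using less.prems by (auto simp: minimal_elements_def)
    have aB: "a \<in> group_closure B" using a(1) A_subset_B group_closure_member by blast
    have "(\<Sum>i = 1..d. \<Lambda> (x - a) i) = (\<Sum>i = 1..d. \<Lambda> x i) - (\<Sum>i = 1..d. \<Lambda> a i)"
      using less.prems aB by (simp add: sum_subtractf[symmetric] coord_diff group_closure_member)
    also have "\<dots> \<le> (\<Sum>i = 1..d. \<Lambda> x i) - 1"
      using coord_sum_ge_1[OF a(1,2)] by simp
    finally have "(\<Sum>i = 1..d. \<Lambda> (x - a) i) + 1 \<le> (\<Sum>i = 1..d. \<Lambda> x i)" by simp
    moreover have "0 \<le> (\<Sum>i = 1..d. \<Lambda> (x - a) i)"
      using coord_B_nonneg[OF a(3)] by (intro sum_nonneg) auto
    ultimately have "nat \<lfloor>\<Sum>i = 1..d. \<Lambda> (x - a) i\<rfloor> < nat \<lfloor>\<Sum>i = 1..d. \<Lambda> x i\<rfloor>"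
      by linarith
    from less.hyps[OF this a(3)] obtain z where "z \<in> minimal_elements B A" "x - a - z \<in> A" by blast
    moreover from this(2) have "x - z \<in> A"
      using monoid_closure.add[OF _ a(1), of "x - a - z"] by (simp add: algebra_simps)
    ultimately show ?thesis by blast
  qed
qed

section \<open>Congruence classes of minimal elements\<close>

lemma classE:
  assumes "\<Gamma> \<in> min_classes"
  obtains x where "x \<in> \<Gamma>" "x \<in> minimal_elements B A"
    "\<Gamma> = {y \<in> minimal_elements B A. x - y \<in> group_closure A}"
  using assms by (auto simp: minimal_classes_def quotient_def)

lemma class_minimal: "\<Gamma> \<in> min_classes \<Longrightarrow> x \<in> \<Gamma> \<Longrightarrow> x \<in> minimal_elements B A"
  by (auto elim: classE)

lemma class_subset_group: "\<Gamma> \<in> min_classes \<Longrightarrow> \<Gamma> \<subseteq> group_closure B"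
  by (elim classE) (auto simp: minimal_elements_def intro: group_closure_member)

lemma class_diff:
  assumes "\<Gamma> \<in> min_classes" "x \<in> \<Gamma>" "y \<in> \<Gamma>"
  shows "x - y \<in> group_closure A"
proof -
  obtain z where "\<Gamma> = {y \<in> minimal_elements B A. z - y \<in> group_closure A}"
    by (rule classE[OF assms(1)])
  with assms(2,3) have "z - y \<in> group_closure A" "z - x \<in> group_closure A" by auto
  then have "(z - y) - (z - x) \<in> group_closure A" by (rule group_closure.diff)
  then show ?thesis by simp
qed

lemma class_closed:
  assumes "\<Gamma> \<in> min_classes" "x \<in> \<Gamma>" "y \<in> minimal_elements B A" "x - y \<in> group_closure A"
  shows "y \<in> \<Gamma>"
proof -
  obtain z where z: "\<Gamma> = {y \<in> minimal_elements B A. z - y \<in> group_closure A}"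
    by (rule classE[OF assms(1)])
  with assms(2) have "z - x \<in> group_closure A" by simp
  from group_closure_add[OF this assms(4)] show ?thesis using z assms(3) by simp
qed

lemma class_of_minimal:
  assumes "x \<in> minimal_elements B A"
  obtains \<Gamma> where "\<Gamma> \<in> min_classes" "x \<in> \<Gamma>"
proof -
  let ?\<Gamma> = "{y \<in> minimal_elements B A. x - y \<in> group_closure A}"
  have "?\<Gamma> \<in> min_classes" "x \<in> ?\<Gamma>"
    using assms by (auto simp: minimal_classes_def quotient_def)
  then show ?thesis by (rule that)
qed

section \<open>The vectors \<open>h \<Gamma>\<close> and their coordinates\<close>

lemma h_in_group: "\<Gamma> \<in> min_classes \<Longrightarrow> h \<Gamma> \<in> group_closure B"
  by (rule h_vec_in_group_closure[OF affine simplicial])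

lemma coord_h:
  assumes "\<Gamma> \<in> min_classes" "i \<in> {1..d}"
  shows "\<Lambda> (h \<Gamma>) i = Min ((\<lambda>x. \<Lambda> x i) ` \<Gamma>)"
  by (rule coord_unique[OF simplicial rat_vec_h_vec[OF affine simplicial assms(1)] assms(2)])

lemma finite_class: "\<Gamma> \<in> min_classes \<Longrightarrow> finite \<Gamma>"
  using finite_minimal_elements[OF affine simplicial] by (auto elim: classE)

lemma coord_h_attained:
  assumes "\<Gamma> \<in> min_classes" "i \<in> {1..d}"
  obtains x where "x \<in> \<Gamma>" "\<Lambda> (h \<Gamma>) i = \<Lambda> x i"
proof -
  have "\<Gamma> \<noteq> {}" using assms(1) by (auto elim: classE)
  then have "\<Lambda> (h \<Gamma>) i \<in> (\<lambda>x. \<Lambda> x i) ` \<Gamma>"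
    unfolding coord_h[OF assms] using finite_class[OF assms(1)] by (intro Min_in) auto
  then show ?thesis using that by blast
qed

lemma coord_h_le:
  assumes "\<Gamma> \<in> min_classes" "i \<in> {1..d}" "x \<in> \<Gamma>"
  shows "\<Lambda> (h \<Gamma>) i \<le> \<Lambda> x i"
  unfolding coord_h[OF assms(1,2)] using finite_class[OF assms(1)] assms(3) by (intro Min_le) auto

text \<open>Integrality is checked one coordinate at a time. In coordinate \<open>i\<close> the
  vector \<open>h \<Gamma>\<close> agrees with some \<open>y\<close> in the class, and
  \<open>y - x\<close> lies in \<open>group_closure A\<close>. The element \<open>y\<close> may
  change with \<open>i\<close>, so \<open>h \<Gamma>\<close> need not belong to \<Gamma>.\<close>

lemma h_diff_in_group_A:
  assumes "\<Gamma> \<in> min_classes" "x \<in> \<Gamma>"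
  shows "h \<Gamma> - x \<in> group_closure A"
proof -
  have xB: "x \<in> group_closure B" using class_subset_group assms by blast
  have "\<Lambda> (h \<Gamma> - x) i \<in> \<int>" if i: "i \<in> {1..d}" for i
  proof -
    obtain y where y: "y \<in> \<Gamma>" "\<Lambda> (h \<Gamma>) i = \<Lambda> y i" by (rule coord_h_attained[OF assms(1) i])
    have yB: "y \<in> group_closure B" using class_subset_group[OF assms(1)] y(1) by blast
    have "\<Lambda> (h \<Gamma> - x) i = \<Lambda> (y - x) i"
      using coord_diff[OF h_in_group[OF assms(1)] xB i] coord_diff[OF yB xB i] y(2) by simp
    then show ?thesis
      using coord_group_A_in_Ints[OF class_diff[OF assms(1) y(1) assms(2)] i] by simp
  qed
  then show ?thesis
    using in_group_A_iff group_closure.diff[OF h_in_group[OF assms(1)] xB] by blast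
qed

text \<open>Each \<open>h \<Gamma>\<close> is congruent to all members of its class, so congruent
  vectors come from classes with congruent members.\<close>

lemma class_eq_if_h_congruent:
  assumes "\<Gamma> \<in> min_classes" "\<Gamma>' \<in> min_classes" "h \<Gamma> - h \<Gamma>' \<in> group_closure A"
  shows "\<Gamma> = \<Gamma>'"
proof -
  \<comment> \<open>One inclusion for arbitrary classes; it is used in both directions at the
    end.\<close>
  have *: "\<Delta>' \<subseteq> \<Delta>"
    if \<Delta>: "\<Delta> \<in> min_classes" "\<Delta>' \<in> min_classes" "h \<Delta> - h \<Delta>' \<in> group_closure A" for \<Delta> \<Delta>'
  proof
    fix y assume y: "y \<in> \<Delta>'"
    obtain x where x: "x \<in> \<Delta>" by (rule classE[OF \<Delta>(1)])
    \<comment> \<open>The sum telescopes to \<open>x - y\<close>.\<close>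
    have "(h \<Delta> - h \<Delta>') + (h \<Delta>' - y) - (h \<Delta> - x) \<in> group_closure A"
      by (intro group_closure.diff group_closure_add \<Delta> h_diff_in_group_A x y)
    then have "x - y \<in> group_closure A" by simp
    moreover have "y \<in> minimal_elements B A" by (rule class_minimal[OF \<Delta>(2) y])
    ultimately show "y \<in> \<Delta>" using class_closed[OF \<Delta>(1) x] by blast
  qed
  have "h \<Gamma>' - h \<Gamma> \<in> group_closure A"
    using group_closure.diff[OF _ assms(3), of 0] by simp
  then show ?thesis using * assms by blast
qed

section \<open>The translates \<open>h \<Gamma> + A\<close> and the monoid they form\<close>

lemma h_translate_unique:
  assumes "\<Gamma> \<in> min_classes" "\<Gamma>' \<in> min_classes" "a \<in> A" "a' \<in> A" "h \<Gamma> + a = h \<Gamma>' + a'"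
  shows "\<Gamma> = \<Gamma>'"
proof (rule class_eq_if_h_congruent[OF assms(1,2)])
  have "h \<Gamma> - h \<Gamma>' = a' - a" using assms(5) by (simp add: algebra_simps)
  then show "h \<Gamma> - h \<Gamma>' \<in> group_closure A"
    using assms(3,4) by (auto intro: group_closure.diff group_closure_member)
qed

text \<open>This exhibits \<open>A\<close> itself as one of the translates. Coordinates on
  \<open>B\<close> are nonnegative, so \<open>B\<close> contains no negative of a nonzero element of
  \<open>A\<close> and \<open>0\<close> is minimal. Another member of its class would be an element
  of \<open>A\<close>, which cannot be minimal.\<close>

lemma zero_class: "{0} \<in> min_classes" and h_zero_class: "h {0} = 0"
proof -
  have "- a \<notin> B" if "a \<in> A" "a \<noteq> 0" for a
  proof
    assume "- a \<in> B"
    have aB: "a \<in> group_closure B" using that A_subset_B group_closure_member by blast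
    have "\<Lambda> a i \<le> 0" if "i \<in> {1..d}" for i
      using coord_B_nonneg[OF \<open>- a \<in> B\<close> that] coord_diff[of 0 a i] coord_diff[of 0 0 i] aB that by simp
    then have "(\<Sum>i = 1..d. \<Lambda> a i) \<le> 0" by (intro sum_nonpos) auto
    with coord_sum_ge_1[OF that] show False by simp
  qed
  then have 0: "0 \<in> minimal_elements B A" by (auto simp: minimal_elements_def zero_in_B)
  then obtain \<Gamma> where \<Gamma>: "\<Gamma> \<in> min_classes" "0 \<in> \<Gamma>" by (rule class_of_minimal)
  have "x = 0" if "x \<in> \<Gamma>" for x
  proof (rule ccontr)
    assume "x \<noteq> 0"
    have min: "x \<in> minimal_elements B A" by (rule class_minimal[OF \<Gamma>(1) that])
    have "x \<in> group_closure A" using class_diff[OF \<Gamma>(1) that \<Gamma>(2)] by simp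
    then have "x \<in> A"
      using min coord_B_nonneg by (intro in_A_if_coord_nonneg) (auto simp: minimal_elements_def)
    \<comment> \<open>Minimality is applied with \<open>x\<close> itself as the nonzero element of
      \<open>A\<close> to be subtracted.\<close>
    then have "x - x \<notin> B" using min \<open>x \<noteq> 0\<close> unfolding minimal_elements_def by blast
    then show False using zero_in_B by simp
  qed
  then have "\<Gamma> = {0}" using \<Gamma>(2) by auto
  with \<Gamma>(1) show *: "{0} \<in> min_classes" by simp
  show "h {0} = 0"
    by (rule eq_if_coord_eq[OF h_in_group[OF *]]) (auto simp: coord_h[OF *])
qed

lemma h_add_in_translate:
  assumes "\<Gamma> \<in> min_classes" "\<Gamma>' \<in> min_classes"
  shows "\<exists>\<Delta> \<in> min_classes. h \<Gamma> + h \<Gamma>' - h \<Delta> \<in> A"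
proof -
  have sumB: "u + v \<in> B" if "u \<in> \<Gamma>" "v \<in> \<Gamma>'" for u v
    using class_minimal[OF assms(1) that(1)] class_minimal[OF assms(2) that(2)] add_in_B
    by (auto simp: minimal_elements_def)
  obtain x where x: "x \<in> \<Gamma>" by (rule classE[OF assms(1)])
  obtain y where y: "y \<in> \<Gamma>'" by (rule classE[OF assms(2)])
  \<comment> \<open>The class of \<open>z\<close> is the candidate. It is fixed by a single pair
    \<open>x\<close>, \<open>y\<close> and has to serve all coordinates at once.\<close>
  obtain z where z: "z \<in> minimal_elements B A" "x + y - z \<in> A"
    using exists_minimal_below[OF sumB[OF x y]] by blast
  obtain \<Delta> where \<Delta>: "\<Delta> \<in> min_classes" "z \<in> \<Delta>" by (rule class_of_minimal[OF z(1)])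
  note hB = h_in_group[OF assms(1)] h_in_group[OF assms(2)] h_in_group[OF \<Delta>(1)]
  have "(h \<Gamma> - x) + (h \<Gamma>' - y) + (x + y - z) - (h \<Delta> - z) \<in> group_closure A"
    by (intro group_closure.diff group_closure_add h_diff_in_group_A assms x y \<Delta>
        group_closure_member[OF z(2)])
  then have "h \<Gamma> + h \<Gamma>' - h \<Delta> \<in> group_closure A" by (simp add: algebra_simps)
  moreover have "0 \<le> \<Lambda> (h \<Gamma> + h \<Gamma>' - h \<Delta>) i" if i: "i \<in> {1..d}" for i
  proof -
    \<comment> \<open>For the fixed coordinate \<open>i\<close>, the minimisers \<open>u\<close> and
      \<open>v\<close> replace \<open>x\<close> and \<open>y\<close>; below their sum lies a minimal
      element \<open>w\<close>.\<close>
    obtain u where u: "u \<in> \<Gamma>" "\<Lambda> (h \<Gamma>) i = \<Lambda> u i" by (rule coord_h_attained[OF assms(1) i])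
    obtain v where v: "v \<in> \<Gamma>'" "\<Lambda> (h \<Gamma>') i = \<Lambda> v i" by (rule coord_h_attained[OF assms(2) i])
    obtain w where w: "w \<in> minimal_elements B A" "u + v - w \<in> A"
      using exists_minimal_below[OF sumB[OF u(1) v(1)]] by blast
    \<comment> \<open>The expression telescopes to \<open>w - z\<close>, so \<open>w\<close> falls
      into the class \<Delta> of \<open>z\<close>.\<close>
    have "(x + y - z) - (x - u) - (y - v) - (u + v - w) \<in> group_closure A"
      by (intro group_closure.diff group_closure_member[OF z(2)] group_closure_member[OF w(2)]
          class_diff[OF assms(1) x u(1)] class_diff[OF assms(2) y v(1)])
    then have "w - z \<in> group_closure A" by (simp add: algebra_simps)
    from group_closure.diff[OF _ this, of 0] have "z - w \<in> group_closure A" by simp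
    then have wD: "w \<in> \<Delta>" using class_closed[OF \<Delta>] w(1) by blast
    have uB: "u \<in> group_closure B" "v \<in> group_closure B" "w \<in> group_closure B"
      using class_subset_group assms \<Delta>(1) u(1) v(1) wD by blast+
    \<comment> \<open>In coordinate \<open>i\<close>, \<open>h \<Delta>\<close> is at most
      \<open>w\<close>, which is at most \<open>u + v\<close>, and \<open>u + v\<close> agrees there
      with \<open>h \<Gamma> + h \<Gamma>'\<close>.\<close>
    have "\<Lambda> (h \<Delta>) i \<le> \<Lambda> w i" by (rule coord_h_le[OF \<Delta>(1) i wD])
    moreover have "0 \<le> \<Lambda> (u + v - w) i" by (rule coord_A_nonneg[OF w(2) i])
    ultimately show ?thesis
      using uB hB u(2) v(2) i by (simp add: coord_add coord_diff group_closure_add)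
  qed
  ultimately show ?thesis using in_A_if_coord_nonneg \<Delta>(1) by blast
qed

lemma monoid_closure_h_eq:
  "monoid_closure (e ` {1..d} \<union> h ` min_classes) = {h \<Gamma> + a | \<Gamma> a. \<Gamma> \<in> min_classes \<and> a \<in> A}"
  (is "?L = ?R")
proof
  \<comment> \<open>The class \<open>{0}\<close> has \<open>h {0} = 0\<close> and contributes the
    translate \<open>A\<close>.\<close>
  have A: "a \<in> ?R" if "a \<in> A" for a
    using that zero_class h_zero_class by (intro CollectI exI[of _ "{0}"] exI[of _ a]) auto
  show "?L \<subseteq> ?R"
  proof
    fix x assume "x \<in> ?L"
    then show "x \<in> ?R"
    proof induction
      case zero
      show ?case by (intro A monoid_closure.zero)
    next
      case (base x)
      then consider "x \<in> A" | \<Gamma> where "\<Gamma> \<in> min_classes" "x = h \<Gamma>"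
        by (auto intro: monoid_closure.base)
      then show ?case
      proof cases
        case 1
        then show ?thesis by (rule A)
      next
        case 2
        then show ?thesis
          by (intro CollectI exI[of _ \<Gamma>] exI[of _ 0]) (auto intro: monoid_closure.zero)
      qed
    next
      case (add x y)
      then obtain \<Gamma> a \<Gamma>' a' where *: "\<Gamma> \<in> min_classes" "a \<in> A" "x = h \<Gamma> + a"
        "\<Gamma>' \<in> min_classes" "a' \<in> A" "y = h \<Gamma>' + a'" by blast
      obtain \<Delta> where \<Delta>: "\<Delta> \<in> min_classes" "h \<Gamma> + h \<Gamma>' - h \<Delta> \<in> A"
        using h_add_in_translate[OF *(1,4)] by blast
      \<comment> \<open>The excess of \<open>h \<Gamma> + h \<Gamma>'\<close> over
        \<open>h \<Delta>\<close> is absorbed into the summand from \<open>A\<close>.\<close>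
      have "x + y = h \<Delta> + (h \<Gamma> + h \<Gamma>' - h \<Delta> + (a + a'))" using * by (simp add: algebra_simps)
      moreover have "h \<Gamma> + h \<Gamma>' - h \<Delta> + (a + a') \<in> A"
        by (intro monoid_closure.add \<Delta> *)
      ultimately show ?case using \<Delta>(1) by blast
    qed
  qed
next
  have "A \<subseteq> ?L"
  proof
    fix x assume "x \<in> A"
    then show "x \<in> ?L" by induction (auto intro: monoid_closure.intros)
  qed
  then show "?R \<subseteq> ?L" by (auto intro!: monoid_closure.add intro: monoid_closure.base)
qed

end


section \<open>Semigroup rings and graded modules\<close>

lemma keys_mult_subset:
  assumes "Poly_Mapping.keys p \<subseteq> P" "Poly_Mapping.keys q \<subseteq> Q" "\<And>a b. a \<in> P \<Longrightarrow> b \<in> Q \<Longrightarrow> a + b \<in> S"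
  shows "Poly_Mapping.keys (p * q) \<subseteq> S"
  using keys_mult[of p q] assms by fastforce

lemma keys_add_subset:
  "Poly_Mapping.keys p \<subseteq> S \<Longrightarrow> Poly_Mapping.keys q \<subseteq> S \<Longrightarrow> Poly_Mapping.keys (p + q) \<subseteq> S"
  using Poly_Mapping.keys_add[of p q] by blast

text \<open>In the convolution at \<open>x\<close> only the pair \<open>h\<close>,
  \<open>x - h\<close> contributes. Solving \<open>x = h + r\<close> for \<open>r\<close> gives both
  sums the shape that \<open>Sum_any_when_equal\<close> collapses.\<close>

lemma lookup_single_mult:
  fixes q :: "'g::ab_group_add \<Rightarrow>\<^sub>0 'k::semiring_1"
  shows "Poly_Mapping.lookup (Poly_Mapping.single h c * q) x = c * Poly_Mapping.lookup q (x - h)"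
proof -
  have "(\<lambda>r. Poly_Mapping.lookup q r when x = h + r) = (\<lambda>r. Poly_Mapping.lookup q r when r = x - h)"
    by (auto simp: fun_eq_iff algebra_simps when_def)
  then have "Sum_any (\<lambda>r. Poly_Mapping.lookup q r when x = h + r) = Poly_Mapping.lookup q (x - h)"
    by (simp only: Sum_any_when_equal)
  then have "(\<lambda>l. (c when h = l) * Sum_any (\<lambda>r. Poly_Mapping.lookup q r when x = l + r))
      = (\<lambda>l. c * Poly_Mapping.lookup q (x - h) when l = h)"
    by (auto simp: fun_eq_iff when_def)
  then show ?thesis by (simp only: lookup_mult lookup_single Sum_any_when_equal)
qed

section \<open>Semigroup rings as graded rings and graded modules\<close>

lemma sg_carrier_zero: "0 \<in> sg_carrier K S"
  and sg_carrier_uminus: "p \<in> sg_carrier K S \<Longrightarrow> - p \<in> sg_carrier K S"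
  by (auto simp: sg_carrier_def)

lemma sg_carrier_add: "p \<in> sg_carrier K S \<Longrightarrow> q \<in> sg_carrier K S \<Longrightarrow> p + q \<in> sg_carrier K S"
  by (simp add: sg_carrier_def keys_add_subset)

lemma sg_carrier_mult:
  assumes "p \<in> sg_carrier K S" "q \<in> sg_carrier K X" "\<And>a b. a \<in> S \<Longrightarrow> b \<in> X \<Longrightarrow> a + b \<in> X"
  shows "p * q \<in> sg_carrier K X"
  using assms keys_mult_subset[of p S q X X] by (simp add: sg_carrier_def)

text \<open>As an intersection of two carriers, a component inherits the closure properties of
  \<open>sg_carrier\<close>.\<close>

lemma sg_component_eq: "sg_component K S g = sg_carrier K S \<inter> sg_carrier K {g}"
  by (auto simp: sg_component_def sg_carrier_def)

text \<open>Stated for any record with these additive fields, so that it serves both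
  \<open>semigroup_ring\<close> and \<open>semigroup_module\<close>.\<close>

lemma sg_carrier_abelian_group:
  fixes M :: "('g::ab_group_add \<Rightarrow>\<^sub>0 'k::field, 'm) ring_scheme"
  assumes "carrier M = sg_carrier K S" "\<zero>\<^bsub>M\<^esub> = 0" "add M = (+)"
  shows "abelian_group M"
proof (rule abelian_groupI)
  fix x assume "x \<in> carrier M"
  then have "- x \<in> carrier M" by (simp add: assms sg_carrier_uminus)
  then show "\<exists>y\<in>carrier M. y \<oplus>\<^bsub>M\<^esub> x = \<zero>\<^bsub>M\<^esub>"
    by (intro bexI[of _ "- x"]) (simp_all add: assms)
qed (simp_all add: assms sg_carrier_zero sg_carrier_add algebra_simps)

lemma semigroup_ring_cring:
  fixes S :: "'g::ab_group_add set"
  assumes "0 \<in> S" "\<And>a b. a \<in> S \<Longrightarrow> b \<in> S \<Longrightarrow> a + b \<in> S"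
  shows "cring (semigroup_ring TYPE('k::field) S)"
proof (rule cringI)
  show "abelian_group (semigroup_ring TYPE('k) S)"
    by (rule sg_carrier_abelian_group) (auto simp: semigroup_ring_def)
  have "(1 :: 'g \<Rightarrow>\<^sub>0 'k) \<in> sg_carrier TYPE('k) S" using assms(1) by (simp add: sg_carrier_def)
  then show "comm_monoid (semigroup_ring TYPE('k) S)"
    using assms(2) by unfold_locales (simp_all add: semigroup_ring_def sg_carrier_mult algebra_simps)
qed (simp add: semigroup_ring_def algebra_simps)

text \<open>Only carrier and operations are prescribed, so twists, which change nothing but the
  components, are covered. The set \<open>X\<close> need only be stable under adding elements of
  \<open>S\<close>.\<close>

lemma sg_carrier_module:
  fixes M :: "('g::ab_group_add \<Rightarrow>\<^sub>0 'k::field, 'g \<Rightarrow>\<^sub>0 'k, 'm) module_scheme"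
  assumes "0 \<in> S" "\<And>a b. a \<in> S \<Longrightarrow> b \<in> S \<Longrightarrow> a + b \<in> S"
    and "\<And>a b. a \<in> S \<Longrightarrow> b \<in> X \<Longrightarrow> a + b \<in> X"
    and M: "carrier M = sg_carrier TYPE('k) X" "\<zero>\<^bsub>M\<^esub> = 0" "add M = (+)" "smult M = (*)"
  shows "Module.module (semigroup_ring TYPE('k) S) M"
proof (rule moduleI)
  show "cring (semigroup_ring TYPE('k) S)" by (rule semigroup_ring_cring[OF assms(1,2)])
  show "abelian_group M" by (rule sg_carrier_abelian_group[OF M(1-3)])
  show "a \<odot>\<^bsub>M\<^esub> x \<in> carrier M" if "a \<in> carrier (semigroup_ring TYPE('k) S)" "x \<in> carrier M" for a x
    using that assms(3) by (auto simp: semigroup_ring_def M intro: sg_carrier_mult)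
qed (simp_all add: semigroup_ring_def M algebra_simps)

text \<open>The homogeneous parts of an element are its monomials; comparing coefficients shows that
  no other decomposition exists.\<close>

lemma sg_component_direct_sum:
  fixes M :: "('g::ab_group_add \<Rightarrow>\<^sub>0 'k::field, 'm) ring_scheme"
  assumes M: "carrier M = sg_carrier TYPE('k) S" "\<zero>\<^bsub>M\<^esub> = 0" "add M = (+)"
  shows "internal_direct_sum M (sg_component TYPE('k) S)"
  unfolding internal_direct_sum_def
proof (intro conjI allI ballI)
  interpret abelian_group M by (rule sg_carrier_abelian_group[OF M])
  have minus: "\<ominus>\<^bsub>M\<^esub> p = - p" if "p \<in> carrier M" for p
    using that by (intro minus_equality) (simp_all add: M sg_carrier_uminus)
  show "additive_subgroup (sg_component TYPE('k) S g) M" for g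
  proof (intro additive_subgroupI add.subgroupI)
    show "sg_component TYPE('k) S g \<noteq> {}"
      unfolding sg_component_eq using sg_carrier_zero by blast
  qed (auto simp: sg_component_eq M minus[unfolded M]
        intro: sg_carrier_add sg_carrier_uminus)
  \<comment> \<open>The sum formed in \<open>M\<close> is the ordinary sum in the group ring, so
    coefficients can be read off.\<close>
  have finsum: "finsum M c F = sum c F" if "finite F" "\<And>g. c g \<in> sg_component TYPE('k) S g"
    for c :: "'g \<Rightarrow> 'g \<Rightarrow>\<^sub>0 'k" and F
    using that(1)
  proof induction
    case (insert x F)
    have "c \<in> insert x F \<rightarrow> carrier M" using that(2) by (auto simp: sg_component_def M)
    with insert show ?case by (simp add: M(3) Pi_iff)
  qed (simp add: M)
  \<comment> \<open>Each \<open>c h\<close> is supported in \<open>{h}\<close>, so the coefficient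
    at \<open>g\<close> comes from \<open>c g\<close> alone. Both existence and uniqueness below
    rest on this.\<close>
  have lookup_sum: "Poly_Mapping.lookup (finsum M c {g. c g \<noteq> 0}) g = Poly_Mapping.lookup (c g) g"
    if c: "\<And>g. c g \<in> sg_component TYPE('k) S g" and fin: "finite {g. c g \<noteq> 0}"
    for c :: "'g \<Rightarrow> 'g \<Rightarrow>\<^sub>0 'k" and g
  proof -
    have "Poly_Mapping.lookup (c h) g = 0" if "h \<noteq> g" for h
      using c[of h] that by (auto simp: sg_component_def simp flip: not_in_keys_iff_lookup_eq_zero)
    then have "(\<Sum>h | c h \<noteq> 0. Poly_Mapping.lookup (c h) g)
        = (\<Sum>h | c h \<noteq> 0. if h = g then Poly_Mapping.lookup (c g) g else 0)"
      by (intro sum.cong) auto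
    \<comment> \<open>If \<open>c g = 0\<close>, then \<open>g\<close> is missing from the index
      set, but the coefficient is zero as well.\<close>
    also have "\<dots> = Poly_Mapping.lookup (c g) g" using fin by simp
    finally show ?thesis using finsum[OF fin c] by (simp add: Poly_Mapping.lookup_sum)
  qed
  fix p assume p: "p \<in> carrier M"
  define c where "c g = Poly_Mapping.single g (Poly_Mapping.lookup p g)" for g
  have c: "c g \<in> sg_component TYPE('k) S g" for g
    using p by (auto simp: c_def M sg_component_def sg_carrier_def simp: in_keys_iff split: if_splits)
  have lookup_c: "Poly_Mapping.lookup (c g) g = Poly_Mapping.lookup p g" for g
    by (simp add: c_def)
  have "{g. c g \<noteq> 0} = Poly_Mapping.keys p"
    by (auto simp: c_def in_keys_iff) (metis lookup_single_eq lookup_zero)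
  then have fin: "finite {g. c g \<noteq> 0}" by simp
  show "\<exists>!c. (\<forall>g. c g \<in> sg_component TYPE('k) S g) \<and> finite {g. c g \<noteq> \<zero>\<^bsub>M\<^esub>} \<and>
          p = finsum M c {g. c g \<noteq> \<zero>\<^bsub>M\<^esub>}"
    unfolding M(2)
  proof (rule ex1I[of _ c], intro conjI allI)
    show "p = finsum M c {g. c g \<noteq> 0}"
      using lookup_sum[OF c fin] by (intro poly_mapping_eqI) (simp only: lookup_c)
    fix c' assume c': "(\<forall>g. c' g \<in> sg_component TYPE('k) S g) \<and> finite {g. c' g \<noteq> 0} \<and>
          p = finsum M c' {g. c' g \<noteq> 0}"
    show "c' = c"
    proof
      fix g
      have eq: "Poly_Mapping.lookup (c' g) g = Poly_Mapping.lookup p g"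
        using lookup_sum[of c' g] c' by simp
      have keys: "Poly_Mapping.keys (c' g) \<subseteq> {g}" using c' by (auto simp: sg_component_def)
      show "c' g = c g"
      proof (rule poly_mapping_eqI)
        fix k
        show "Poly_Mapping.lookup (c' g) k = Poly_Mapping.lookup (c g) k"
          using eq keys by (cases "k = g") (auto simp: c_def lookup_single in_keys_iff)
      qed
    qed
  qed (use c fin in auto)
qed

lemma sg_component_mult:
  assumes "p \<in> sg_component K S g" "q \<in> sg_component K X h" "\<And>a b. a \<in> S \<Longrightarrow> b \<in> X \<Longrightarrow> a + b \<in> X"
  shows "p * q \<in> sg_component K X (g + h)"
proof -
  have "Poly_Mapping.keys (p * q) \<subseteq> {g + h}"
    using assms(1,2) by (intro keys_mult_subset[of p "{g}" q "{h}"]) (auto simp: sg_component_def)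
  with assms show ?thesis by (auto simp: sg_component_def intro: sg_carrier_mult)
qed

lemma semigroup_ring_graded:
  fixes S :: "'g::ab_group_add set"
  assumes "0 \<in> S" "\<And>a b. a \<in> S \<Longrightarrow> b \<in> S \<Longrightarrow> a + b \<in> S"
  shows "is_graded_ring (semigroup_ring TYPE('k::field) S)"
proof -
  have "internal_direct_sum (semigroup_ring TYPE('k) S) (sg_component TYPE('k) S)"
    by (rule sg_component_direct_sum) (auto simp: semigroup_ring_def)
  then show ?thesis
    unfolding is_graded_ring_def using semigroup_ring_cring[OF assms] assms(2)
    by (auto simp: semigroup_ring_def intro: sg_component_mult)
qed

lemma semigroup_module_graded:
  fixes S X :: "'g::ab_group_add set"
  assumes "0 \<in> S" "\<And>a b. a \<in> S \<Longrightarrow> b \<in> S \<Longrightarrow> a + b \<in> S"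
    and "\<And>a b. a \<in> S \<Longrightarrow> b \<in> X \<Longrightarrow> a + b \<in> X"
  shows "is_graded_module (semigroup_ring TYPE('k::field) S) (semigroup_module TYPE('k) X)"
proof -
  have "internal_direct_sum (semigroup_module TYPE('k) X) (sg_component TYPE('k) X)"
    by (rule sg_component_direct_sum) (auto simp: semigroup_module_def)
  moreover have "Module.module (semigroup_ring TYPE('k) S) (semigroup_module TYPE('k) X)"
    by (rule sg_carrier_module[OF assms]) (auto simp: semigroup_module_def)
  ultimately show ?thesis
    unfolding is_graded_module_def using semigroup_ring_graded[OF assms(1,2)] assms(3)
    by (auto simp: semigroup_ring_def semigroup_module_def intro: sg_component_mult)
qed

section \<open>Direct sums, and transport of gradings along bijections\<close>

lemma graded_direct_sum_module:
  fixes M :: "'i \<Rightarrow> ('g, 'a, 'b) graded_module"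
  assumes R: "cring R" and M: "\<And>i. i \<in> I \<Longrightarrow> Module.module R (M i)"
  shows "Module.module R (graded_direct_sum I M)"
proof (rule moduleI)
  let ?N = "graded_direct_sum I M"
  have ag: "abelian_group (M i)" if "i \<in> I" for i
    using M[OF that] by (simp add: Module.module_def)
  have am: "abelian_monoid (M i)" if "i \<in> I" for i
    using ag[OF that] by (simp add: abelian_group_def)
  note closed = abelian_monoid.a_closed[OF am] abelian_monoid.zero_closed[OF am]
    abelian_group.a_inv_closed[OF ag] module.smult_closed[OF M]
  have minus_zero: "\<ominus>\<^bsub>M i\<^esub> \<zero>\<^bsub>M i\<^esub> = \<zero>\<^bsub>M i\<^esub>" if "i \<in> I" for i
    using abelian_group.minus_equality[OF ag] abelian_monoid.l_zero[OF am] closed(2) that by blast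
  note simps = abelian_monoid.l_zero[OF am] abelian_group.l_neg[OF ag]
    minus_zero module.smult_r_null[OF M]
  show "cring R" by fact
  show "abelian_group ?N"
  proof (rule abelian_groupI)
    fix x y assume xy: "x \<in> carrier ?N" "y \<in> carrier ?N"
    \<comment> \<open>The support of a sum lies in the union of the supports and stays finite;
      negation and scalar multiplication below only shrink a support.\<close>
    have "{i \<in> I. x i \<oplus>\<^bsub>M i\<^esub> y i \<noteq> \<zero>\<^bsub>M i\<^esub>}
        \<subseteq> {i \<in> I. x i \<noteq> \<zero>\<^bsub>M i\<^esub>} \<union> {i \<in> I. y i \<noteq> \<zero>\<^bsub>M i\<^esub>}"
      using simps(1) closed(2) by auto
    then have "finite {i \<in> I. x i \<oplus>\<^bsub>M i\<^esub> y i \<noteq> \<zero>\<^bsub>M i\<^esub>}"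
      by (rule finite_subset) (use xy in \<open>simp add: graded_direct_sum_def\<close>)
    then show "x \<oplus>\<^bsub>?N\<^esub> y \<in> carrier ?N"
      using xy closed(1) by (auto simp: graded_direct_sum_def PiE_iff cong: conj_cong)
    show "x \<oplus>\<^bsub>?N\<^esub> y = y \<oplus>\<^bsub>?N\<^esub> x"
      using xy abelian_monoid.a_comm[OF am]
      by (auto simp: graded_direct_sum_def PiE_iff intro!: restrict_ext)
    {
      fix z assume "z \<in> carrier ?N"
      with xy show "x \<oplus>\<^bsub>?N\<^esub> y \<oplus>\<^bsub>?N\<^esub> z = x \<oplus>\<^bsub>?N\<^esub> (y \<oplus>\<^bsub>?N\<^esub> z)"
        using abelian_monoid.a_assoc[OF am]
        by (auto simp: graded_direct_sum_def PiE_iff intro!: restrict_ext)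
    }
  next
    show "\<zero>\<^bsub>?N\<^esub> \<in> carrier ?N"
      using closed(2) by (auto simp: graded_direct_sum_def PiE_iff cong: conj_cong)
  next
    fix x assume x: "x \<in> carrier ?N"
    show "\<zero>\<^bsub>?N\<^esub> \<oplus>\<^bsub>?N\<^esub> x = x"
      using x simps(1) by (auto simp: graded_direct_sum_def PiE_iff extensional_def)
    let ?y = "\<lambda>i\<in>I. \<ominus>\<^bsub>M i\<^esub> x i"
    have "{i \<in> I. \<ominus>\<^bsub>M i\<^esub> x i \<noteq> \<zero>\<^bsub>M i\<^esub>} \<subseteq> {i \<in> I. x i \<noteq> \<zero>\<^bsub>M i\<^esub>}"
      using simps(3) by auto
    then have "finite {i \<in> I. \<ominus>\<^bsub>M i\<^esub> x i \<noteq> \<zero>\<^bsub>M i\<^esub>}"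
      by (rule finite_subset) (use x in \<open>simp add: graded_direct_sum_def\<close>)
    then have "?y \<in> carrier ?N"
      using x closed(3) by (auto simp: graded_direct_sum_def PiE_iff cong: conj_cong)
    moreover have "?y \<oplus>\<^bsub>?N\<^esub> x = \<zero>\<^bsub>?N\<^esub>"
      using x simps(2) by (auto simp: graded_direct_sum_def PiE_iff intro!: restrict_ext)
    ultimately show "\<exists>y\<in>carrier ?N. y \<oplus>\<^bsub>?N\<^esub> x = \<zero>\<^bsub>?N\<^esub>" by blast
  qed
  fix a x assume ax: "a \<in> carrier R" "x \<in> carrier ?N"
  have "{i \<in> I. a \<odot>\<^bsub>M i\<^esub> x i \<noteq> \<zero>\<^bsub>M i\<^esub>} \<subseteq> {i \<in> I. x i \<noteq> \<zero>\<^bsub>M i\<^esub>}"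
    using simps(4) ax by fastforce
  then have "finite {i \<in> I. a \<odot>\<^bsub>M i\<^esub> x i \<noteq> \<zero>\<^bsub>M i\<^esub>}"
    by (rule finite_subset) (use ax in \<open>simp add: graded_direct_sum_def\<close>)
  then show "a \<odot>\<^bsub>?N\<^esub> x \<in> carrier ?N"
    using ax closed(4) by (auto simp: graded_direct_sum_def PiE_iff cong: conj_cong)
  {
    fix y assume "y \<in> carrier ?N"
    with ax show "a \<odot>\<^bsub>?N\<^esub> (x \<oplus>\<^bsub>?N\<^esub> y) = a \<odot>\<^bsub>?N\<^esub> x \<oplus>\<^bsub>?N\<^esub> a \<odot>\<^bsub>?N\<^esub> y"
      using module.smult_r_distr[OF M]
      by (auto simp: graded_direct_sum_def PiE_iff intro!: restrict_ext)
  }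
  {
    fix b assume "b \<in> carrier R"
    with ax show "(a \<oplus>\<^bsub>R\<^esub> b) \<odot>\<^bsub>?N\<^esub> x = a \<odot>\<^bsub>?N\<^esub> x \<oplus>\<^bsub>?N\<^esub> b \<odot>\<^bsub>?N\<^esub> x"
      using module.smult_l_distr[OF M]
      by (auto simp: graded_direct_sum_def PiE_iff intro!: restrict_ext)
  }
  {
    fix b assume "b \<in> carrier R"
    with ax show "(a \<otimes>\<^bsub>R\<^esub> b) \<odot>\<^bsub>?N\<^esub> x = a \<odot>\<^bsub>?N\<^esub> (b \<odot>\<^bsub>?N\<^esub> x)"
      using module.smult_assoc1[OF M]
      by (auto simp: graded_direct_sum_def PiE_iff intro!: restrict_ext)
  }
next
  fix x assume x: "x \<in> carrier (graded_direct_sum I M)"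
  then show "\<one>\<^bsub>R\<^esub> \<odot>\<^bsub>graded_direct_sum I M\<^esub> x = x"
    using module.smult_one[OF M] by (auto simp: graded_direct_sum_def PiE_iff extensional_def)
qed

text \<open>An additive bijection matches decompositions in \<open>N\<close> with decompositions in
  \<open>M\<close>. The grading of an external direct sum is obtained this way, without decomposing
  its elements by hand.\<close>

lemma internal_direct_sum_transfer:
  fixes M :: "('b, 'm) ring_scheme" and N :: "('c, 'n) ring_scheme"
  assumes "abelian_group M" "abelian_group N"
    and bij: "bij_betw f (carrier N) (carrier M)"
    and add: "\<And>x y. x \<in> carrier N \<Longrightarrow> y \<in> carrier N \<Longrightarrow> f (x \<oplus>\<^bsub>N\<^esub> y) = f x \<oplus>\<^bsub>M\<^esub> f y"
    and D: "\<And>g. D g \<subseteq> carrier N" "\<And>g. f ` D g = C g"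
    and sum: "internal_direct_sum M C"
  shows "internal_direct_sum N D"
proof -
  interpret M: abelian_group M by fact
  interpret N: abelian_group N by fact
  interpret f: abelian_group_hom N M f
    using bij add by (intro abelian_group_homI group_hom.intro group_hom_axioms.intro
        \<open>abelian_group M\<close> \<open>abelian_group N\<close> M.a_group N.a_group)
      (auto simp: hom_def bij_betw_def)
  have inj: "x = y" if "x \<in> carrier N" "y \<in> carrier N" "f x = f y" for x y
    using that bij by (auto simp: bij_betw_def inj_on_def)
  \<comment> \<open>Injectivity makes \<open>f\<close> reflect membership in the components as well
    as preserve it.\<close>
  have D_iff: "x \<in> D g \<longleftrightarrow> f x \<in> C g" if "x \<in> carrier N" for x g
  proof
    assume "f x \<in> C g"
    then obtain y where y: "y \<in> D g" "f x = f y" using D(2)[of g] by blast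
    then have "x = y" using inj[OF that] D(1) by blast
    with y show "x \<in> D g" by simp
  qed (use D(2) in blast)
  have C: "additive_subgroup (C g) M" for g using sum by (simp add: internal_direct_sum_def)
  have D_sub: "additive_subgroup (D g) N" for g
  proof (intro additive_subgroupI N.add.subgroupI)
    show "D g \<noteq> {}" using D_iff[OF N.zero_closed, of g] additive_subgroup.zero_closed[OF C] by auto
    fix x assume x: "x \<in> D g"
    then have xN: "x \<in> carrier N" using D by blast
    show "\<ominus>\<^bsub>N\<^esub> x \<in> D g"
      using x xN D_iff additive_subgroup.a_inv_closed[OF C] by simp
    fix y assume y: "y \<in> D g"
    then have yN: "y \<in> carrier N" using D by blast
    show "x \<oplus>\<^bsub>N\<^esub> y \<in> D g"
      using x y xN yN D_iff additive_subgroup.a_closed[OF C] by simp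
  qed (use D in auto)
  have hom_finsum: "f (finsum N c F) = finsum M (\<lambda>g. f (c g)) F" if "finite F" "\<And>g. c g \<in> carrier N"
    for c :: "_ \<Rightarrow> _" and F
    using that(1) by induction (use that(2) in \<open>simp_all add: Pi_iff\<close>)
  have supp: "{g. c g \<noteq> \<zero>\<^bsub>N\<^esub>} = {g. f (c g) \<noteq> \<zero>\<^bsub>M\<^esub>}" if "\<And>g. c g \<in> carrier N" for c :: "_ \<Rightarrow> _"
    using that inj[OF _ N.zero_closed] f.hom_zero by auto
  show ?thesis
    unfolding internal_direct_sum_def
  proof (intro conjI allI ballI D_sub)
    fix n assume n: "n \<in> carrier N"
    then have "f n \<in> carrier M" by simp
    then have ex1: "\<exists>!c. (\<forall>g. c g \<in> C g) \<and> finite {g. c g \<noteq> \<zero>\<^bsub>M\<^esub>} \<and>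
        f n = finsum M c {g. c g \<noteq> \<zero>\<^bsub>M\<^esub>}" (is "\<exists>!c. ?P c")
      using sum by (simp add: internal_direct_sum_def)
    let ?Q = "\<lambda>c. (\<forall>g. c g \<in> D g) \<and> finite {g. c g \<noteq> \<zero>\<^bsub>N\<^esub>} \<and>
        n = finsum N c {g. c g \<noteq> \<zero>\<^bsub>N\<^esub>}"
    have PQ: "?Q c \<longleftrightarrow> ?P (\<lambda>g. f (c g))" if c: "\<And>g. c g \<in> carrier N" for c
    proof -
      have "n = finsum N c F \<longleftrightarrow> f n = finsum M (\<lambda>g. f (c g)) F" if "finite F" for F
        using inj[OF n, of "finsum N c F"] hom_finsum[OF that c] c by auto
      then show ?thesis using D_iff[OF c] unfolding supp[OF c] by auto
    qed
    from ex1 obtain c where c: "?P c" and c_unique: "\<forall>b. ?P b \<longrightarrow> b = c"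
      unfolding Ex1_def by (elim exE conjE) (rule that, (intro conjI; assumption), assumption)
    then have "\<forall>g. \<exists>x \<in> carrier N. f x = c g" using D by (metis image_iff subsetD)
    then obtain c' where c': "\<And>g. c' g \<in> carrier N" "\<And>g. f (c' g) = c g" by metis
    show "\<exists>!c. ?Q c"
    proof (rule ex1I[of _ c'])
      show "?Q c'" using c unfolding PQ[OF c'(1)] c'(2) .
      fix c'' assume Q: "?Q c''"
      then have N: "c'' g \<in> carrier N" for g using D by blast
      \<comment> \<open>Any other decomposition of \<open>n\<close> has the image \<open>c\<close>
        by uniqueness in \<open>M\<close>, hence equals \<open>c'\<close> by injectivity.\<close>
      have P: "?P (\<lambda>g. f (c'' g))" using Q unfolding PQ[OF N] .
      have "(\<lambda>g. f (c'' g)) = c" by (rule c_unique[THEN spec, THEN mp, OF P])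
      then have "f (c'' g) = f (c' g)" for g unfolding c'(2) by (rule fun_cong)
      then show "c'' = c'" by (intro ext inj N c'(1))
    qed
  qed
qed

text \<open>The map \<open>f\<close> runs from \<open>N\<close> to \<open>M\<close>, against the
  direction of the conclusion: only \<open>M\<close> is known to be graded. The grading of
  \<open>N\<close> is pulled back along \<open>f\<close>, and the inverse of \<open>f\<close> is the
  required isomorphism.\<close>

lemma graded_isomorphicI:
  assumes M: "is_graded_module R M" and N: "Module.module R N"
    and sub: "\<And>g. component N g \<subseteq> carrier N" and f: "f \<in> graded_module_iso R N M"
  shows "graded_isomorphic R M N"
proof -
  interpret N: Module.module R N by fact
  interpret M: Module.module R M using M by (simp add: is_graded_module_def)
  have bij: "bij_betw f (carrier N) (carrier M)"
    and add: "\<And>x y. x \<in> carrier N \<Longrightarrow> y \<in> carrier N \<Longrightarrow> f (x \<oplus>\<^bsub>N\<^esub> y) = f x \<oplus>\<^bsub>M\<^esub> f y"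
    and smult: "\<And>a x. a \<in> carrier R \<Longrightarrow> x \<in> carrier N \<Longrightarrow> f (a \<odot>\<^bsub>N\<^esub> x) = a \<odot>\<^bsub>M\<^esub> f x"
    and comp: "\<And>g. f ` component N g = component M g"
    using f by (auto simp: graded_module_iso_def)
  have inj: "inj_on f (carrier N)" using bij by (simp add: bij_betw_def)
  have "internal_direct_sum N (component N)"
    using M by (intro internal_direct_sum_transfer[OF M.abelian_group_axioms
          N.abelian_group_axioms bij add sub comp]) (auto simp: is_graded_module_def)
  moreover have "a \<odot>\<^bsub>N\<^esub> n \<in> component N (g + h)"
    if a: "a \<in> ring_component R g" and n: "n \<in> component N h" for a n g h
  proof -
    have "additive_subgroup (ring_component R g) R"
      using M by (simp add: is_graded_module_def is_graded_ring_def internal_direct_sum_def)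
    from additive_subgroup.a_subset[OF this] have aR: "a \<in> carrier R" using a by blast
    have nN: "n \<in> carrier N" using n sub by blast
    have "f n \<in> component M h" using n comp by blast
    with M a have "a \<odot>\<^bsub>M\<^esub> f n \<in> component M (g + h)" by (simp add: is_graded_module_def)
    then have "f (a \<odot>\<^bsub>N\<^esub> n) \<in> f ` component N (g + h)" by (simp add: comp smult aR nN)
    then show ?thesis
      \<comment> \<open>The product lies in the component because its image does and
        \<open>f\<close> is injective.\<close>
      using inj_on_image_mem_iff[OF inj _ sub] N.smult_closed[OF aR nN] by blast
  qed
  ultimately have "is_graded_module R N"
    using M N by (simp add: is_graded_module_def)
  moreover have "inv_into (carrier N) f \<in> graded_module_iso R M N"
  proof -
    let ?g = "inv_into (carrier N) f"
    have g: "?g (f x) = x" if "x \<in> carrier N" for x using inj that by simp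
    have surj: "\<exists>x \<in> carrier N. y = f x" if "y \<in> carrier M" for y
      using bij that by (auto simp: bij_betw_def)
    have "?g (x \<oplus>\<^bsub>M\<^esub> y) = ?g x \<oplus>\<^bsub>N\<^esub> ?g y" if "x \<in> carrier M" "y \<in> carrier M" for x y
      using surj[OF that(1)] surj[OF that(2)] g by (auto simp flip: add)
    moreover have "?g (a \<odot>\<^bsub>M\<^esub> x) = a \<odot>\<^bsub>N\<^esub> ?g x" if "a \<in> carrier R" "x \<in> carrier M" for a x
      using surj[OF that(2)] g that(1) by (auto simp flip: smult)
    moreover have "?g ` component M k = component N k" for k
      using inv_into_image_cancel[OF inj sub] unfolding comp .
    ultimately show ?thesis
      using bij_betw_inv_into[OF bij] by (auto simp: graded_module_iso_def)
  qed
  ultimately show ?thesis using M by (auto simp: graded_isomorphic_def)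
qed

section \<open>The ring of a disjoint union of translates as a sum of twisted free modules\<close>

lemma semigroup_ring_decomposition:
  fixes A X :: "'g::ab_group_add set" and h :: "'i \<Rightarrow> 'g"
  assumes "finite I" and A: "0 \<in> A" "\<And>a b. a \<in> A \<Longrightarrow> b \<in> A \<Longrightarrow> a + b \<in> A"
    and X: "X = {h i + a | i a. i \<in> I \<and> a \<in> A}"
    and unique: "\<And>i j a b. i \<in> I \<Longrightarrow> j \<in> I \<Longrightarrow> a \<in> A \<Longrightarrow> b \<in> A \<Longrightarrow> h i + a = h j + b \<Longrightarrow> i = j"
  shows "graded_isomorphic (semigroup_ring TYPE('k::field) A) (semigroup_module TYPE('k) X)
           (graded_direct_sum I (\<lambda>i. twist (semigroup_module TYPE('k) A) (- h i)))"
proof (rule graded_isomorphicI)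
  let ?R = "semigroup_ring TYPE('k) A" and ?M = "semigroup_module TYPE('k) X"
  let ?N = "graded_direct_sum I (\<lambda>i. twist (semigroup_module TYPE('k) A) (- h i))"
  have AX: "a + x \<in> X" if ax: "a \<in> A" "x \<in> X" for a x
  proof -
    obtain i b where ib: "i \<in> I" "b \<in> A" "x = h i + b" using ax X by blast
    then have "a + x = h i + (a + b)" by (simp add: algebra_simps)
    then show ?thesis using ib A(2)[OF ax(1) ib(2)] X by blast
  qed
  show "is_graded_module ?R ?M" by (rule semigroup_module_graded[OF A AX])
  show "Module.module ?R ?N"
    by (intro graded_direct_sum_module semigroup_ring_cring[OF A] sg_carrier_module[OF A A(2)])
       (auto simp: twist_def semigroup_module_def)
  show sub: "component ?N g \<subseteq> carrier ?N" for g
    by (auto simp: graded_direct_sum_def twist_def semigroup_module_def sg_component_def PiE_iff)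
  \<comment> \<open>The condition of finite support disappears because \<open>I\<close> is finite;
    twisting by \<open>- h i\<close> turns degree \<open>g\<close> into degree
    \<open>g - h i\<close>.\<close>
  have N: "carrier ?N = (\<Pi>\<^sub>E i\<in>I. sg_carrier TYPE('k) A)"
    "component ?N = (\<lambda>g. \<Pi>\<^sub>E i\<in>I. sg_component TYPE('k) A (g - h i))"
    "add ?N = (\<lambda>x y. \<lambda>i\<in>I. x i + y i)" "smult ?N = (\<lambda>a x. \<lambda>i\<in>I. a * x i)"
    using \<open>finite I\<close> by (auto simp: graded_direct_sum_def twist_def semigroup_module_def)
  have M: "carrier ?M = sg_carrier TYPE('k) X" "component ?M = sg_component TYPE('k) X"
    "add ?M = (+)" "smult ?M = (*)"
    by (auto simp: semigroup_module_def)
  \<comment> \<open>The generator of the \<open>i\<close>-th summand goes to the monomial with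
    exponent \<open>h i\<close>, which also has the degree that the twist assigns to the
    generator.\<close>
  define f :: "('i \<Rightarrow> 'g \<Rightarrow>\<^sub>0 'k) \<Rightarrow> 'g \<Rightarrow>\<^sub>0 'k"
    where "f q = (\<Sum>i\<in>I. Poly_Mapping.single (h i) 1 * q i)" for q
  have lookup_f: "Poly_Mapping.lookup (f q) x = (\<Sum>i\<in>I. Poly_Mapping.lookup (q i) (x - h i))" for q x
    by (simp add: f_def Poly_Mapping.lookup_sum lookup_single_mult)
  have keys_q: "Poly_Mapping.keys (q i) \<subseteq> A" if "q \<in> carrier ?N" "i \<in> I" for q i
    using that by (auto simp: N sg_carrier_def PiE_iff)
  \<comment> \<open>The translates are disjoint, so at \<open>h i + a\<close> only the
    \<open>i\<close>-th summand contributes: a contribution from \<open>j\<close> would put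
    \<open>h i + a\<close> into \<open>h j + A\<close>. Hence \<open>f q\<close> determines every
    \<open>q i\<close>.\<close>
  have lookup_f_translate: "Poly_Mapping.lookup (f q) (h i + a) = Poly_Mapping.lookup (q i) a"
    if "q \<in> carrier ?N" "i \<in> I" "a \<in> A" for q i a
  proof -
    have "Poly_Mapping.lookup (q j) (h i + a - h j) = 0" if j: "j \<in> I" "j \<noteq> i" for j
    proof (rule ccontr)
      assume "Poly_Mapping.lookup (q j) (h i + a - h j) \<noteq> 0"
      then have "h i + a - h j \<in> A"
        using keys_q[OF \<open>q \<in> carrier ?N\<close> j(1)] by (simp add: subset_iff in_keys_iff)
      from unique[OF \<open>i \<in> I\<close> j(1) \<open>a \<in> A\<close> this] j(2) show False by simp
    qed
    then have "(\<Sum>j\<in>I. Poly_Mapping.lookup (q j) (h i + a - h j))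
        = (\<Sum>j\<in>I. if j = i then Poly_Mapping.lookup (q i) a else 0)"
      by (intro sum.cong) auto
    then show ?thesis using \<open>finite I\<close> \<open>i \<in> I\<close> by (simp add: lookup_f)
  qed
  have keys_f: "Poly_Mapping.keys (f q) \<subseteq> X" if "q \<in> carrier ?N" for q
  proof
    fix x assume "x \<in> Poly_Mapping.keys (f q)"
    then obtain i where i: "i \<in> I" "Poly_Mapping.lookup (q i) (x - h i) \<noteq> 0"
      unfolding in_keys_iff lookup_f by (meson sum.neutral)
    then have "x - h i \<in> A" using keys_q[OF that i(1)] by (simp add: subset_iff in_keys_iff)
    then show "x \<in> X" unfolding X using i(1) by (intro CollectI exI[of _ i] exI[of _ "x - h i"]) auto
  qed
  have inj: "inj_on f (carrier ?N)"
  proof (rule inj_onI)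
    fix q r assume qr: "q \<in> carrier ?N" "r \<in> carrier ?N" "f q = f r"
    show "q = r"
    proof (rule PiE_ext)
      show "q \<in> (\<Pi>\<^sub>E i\<in>I. sg_carrier TYPE('k) A)" "r \<in> (\<Pi>\<^sub>E i\<in>I. sg_carrier TYPE('k) A)"
        using qr by (auto simp: N)
      fix i assume i: "i \<in> I"
      show "q i = r i"
      proof (rule poly_mapping_eqI)
        fix a
        show "Poly_Mapping.lookup (q i) a = Poly_Mapping.lookup (r i) a"
        proof (cases "a \<in> A")
          case True
          then show ?thesis
            using lookup_f_translate[OF qr(1) i] lookup_f_translate[OF qr(2) i] qr(3) by metis
        next
          case False
          then have "a \<notin> Poly_Mapping.keys (q i)" "a \<notin> Poly_Mapping.keys (r i)"
            using qr i by (auto simp: N sg_carrier_def PiE_iff)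
          then show ?thesis by (simp add: in_keys_iff)
        qed
      qed
    qed
  qed
  \<comment> \<open>By the previous coefficient formulas, \<open>f\<close> both preserves and
    reflects homogeneity of degree \<open>g\<close>.\<close>
  have f_comp: "f q \<in> component ?M g \<longleftrightarrow> q \<in> component ?N g" if q: "q \<in> carrier ?N" for q g
  proof
    assume fq: "f q \<in> component ?M g"
    have "Poly_Mapping.keys (q i) \<subseteq> {g - h i}" if i: "i \<in> I" for i
    proof
      fix a assume a: "a \<in> Poly_Mapping.keys (q i)"
      then have "a \<in> A" using q i by (auto simp: N sg_carrier_def PiE_iff)
      from lookup_f_translate[OF q i this] a have "h i + a \<in> Poly_Mapping.keys (f q)"
        by (simp add: in_keys_iff)
      then show "a \<in> {g - h i}" using fq by (auto simp: M sg_component_def)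
    qed
    then show "q \<in> component ?N g" using q by (auto simp: N sg_component_def PiE_iff)
  next
    assume "q \<in> component ?N g"
    then have *: "Poly_Mapping.keys (q i) \<subseteq> {g - h i}" if "i \<in> I" for i
      using that by (auto simp: N sg_component_def PiE_iff)
    have "x = g" if "x \<in> Poly_Mapping.keys (f q)" for x
    proof -
      obtain i where "i \<in> I" "Poly_Mapping.lookup (q i) (x - h i) \<noteq> 0"
        using \<open>x \<in> Poly_Mapping.keys (f q)\<close> unfolding in_keys_iff lookup_f by (meson sum.neutral)
      then show ?thesis using *[of i] by (auto simp: in_keys_iff)
    qed
    then show "f q \<in> component ?M g" using keys_f[OF q] by (auto simp: M sg_component_def sg_carrier_def)
  qed
  have surj: "f ` carrier ?N = carrier ?M"
  proof
    show "f ` carrier ?N \<subseteq> carrier ?M" using keys_f by (auto simp: M sg_carrier_def)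
    show "carrier ?M \<subseteq> f ` carrier ?N"
    proof
      fix p assume p: "p \<in> carrier ?M"
      \<comment> \<open>The part of \<open>p\<close> supported on the \<open>i\<close>-th translate,
        shifted back by \<open>h i\<close>, is the \<open>i\<close>-th entry of the
        preimage.\<close>
      define q where "q = (\<lambda>i\<in>I. \<Sum>a | a \<in> A \<and> h i + a \<in> Poly_Mapping.keys p.
        Poly_Mapping.single a (Poly_Mapping.lookup p (h i + a)))"
      have fin: "finite {a \<in> A. h i + a \<in> Poly_Mapping.keys p}" for i
        by (rule finite_subset[of _ "(\<lambda>x. x - h i) ` Poly_Mapping.keys p"])
          (auto intro: image_eqI[of _ _ "h i + _"])
      have lq: "Poly_Mapping.lookup (q i) a = (if a \<in> A then Poly_Mapping.lookup p (h i + a) else 0)"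
        if "i \<in> I" for i a
        using that fin by (auto simp: q_def Poly_Mapping.lookup_sum lookup_single when_def in_keys_iff)
      have q: "q \<in> carrier ?N"
        using lq by (auto simp: N sg_carrier_def PiE_iff in_keys_iff q_def split: if_splits)
      have "f q = p"
      proof (rule poly_mapping_eqI)
        fix x
        show "Poly_Mapping.lookup (f q) x = Poly_Mapping.lookup p x"
        proof (cases "x \<in> X")
          case True
          then obtain i a where "i \<in> I" "a \<in> A" "x = h i + a" using X by blast
          then show ?thesis using lookup_f_translate[OF q] lq by simp
        next
          case False
          then have "x \<notin> Poly_Mapping.keys (f q)" "x \<notin> Poly_Mapping.keys p"
            using keys_f[OF q] p by (auto simp: M sg_carrier_def)
          then show ?thesis by (simp add: in_keys_iff)
        qed
      qed
      then show "p \<in> f ` carrier ?N" using q by blast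
    qed
  qed
  have "f ` component ?N g = component ?M g" for g
  proof
    show "f ` component ?N g \<subseteq> component ?M g" using f_comp sub by blast
    have "component ?M g \<subseteq> f ` carrier ?N" unfolding surj by (auto simp: M sg_component_def)
    then show "component ?M g \<subseteq> f ` component ?N g" using f_comp by blast
  qed
  then show "f \<in> graded_module_iso ?R ?N ?M"
    \<comment> \<open>Additivity and \<open>T\<close>-linearity follow from the defining sum of
      \<open>f\<close> by distributivity.\<close>
    using inj surj
    by (auto simp: graded_module_iso_def bij_betw_def N(3,4) M(3,4) f_def sum.distrib
        sum_distrib_left algebra_simps intro!: sum.cong)
qed

theorem proposition3p4:
  fixes B A Btilde :: "(int ^ 'n::finite) set"
    and d :: nat and e :: "nat \<Rightarrow> int ^ 'n"
  assumes "affine_semigroup B"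
    and "simplicial_by B d e"
    and "A = monoid_closure (e ` {1..d})"
    and "Btilde = monoid_closure (e ` {1..d} \<union> h_vec d e ` minimal_classes B A)"
  shows "graded_isomorphic
           (semigroup_ring TYPE('k::field) A)
           (semigroup_module TYPE('k) Btilde)
           (graded_direct_sum (minimal_classes B A)
              (\<lambda>\<Gamma>. twist (semigroup_module TYPE('k) A) (- h_vec d e \<Gamma>)))"
proof -
  interpret simplicial_semigroup B d e using assms(1,2) by unfold_locales
  show ?thesis
    unfolding assms(3,4)
    \<comment> \<open>The index set is the finite set of classes; \<open>monoid_closure_h_eq\<close>
      provides the union of translates and \<open>h_translate_unique\<close> its
      disjointness.\<close>
    by (intro semigroup_ring_decomposition finite_minimal_classes[OF assms(1,2)]
        monoid_closure_h_eq monoid_closure.zero monoid_closure.add h_translate_unique)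
qed

end
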